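(* Let $X_1,\ldots,X_n$ be generated from the model $X_i=\mu+\delta\mathbf 1\{i>k^*\}+\varepsilon_i$, with the innovations $(\varepsilon_i)_{i\in\mathbb Z}$ satisfying the weak dependence assumption (D) stated in the context, and suppose that $H_A$ holds, i.e. $\delta\neq0$ in $L^2[0,1]$. Then $T_n\stackrel{P}{\to}\infty$ as $n\to\infty$.
   Context: $\|\cdot\|$ is the norm of $L^2[0,1]$. Model: $X_i=\mu+\delta\mathbf 1\{i>k^*\}+\varepsilon_i$, $i\in\mathbb Z$, where $\mu,\delta\in L^2[0,1]$ are deterministic and do not depend on $n$, $k^*=\lfloor\theta n\rfloor$ with $\theta\in(0,1)$ fixed, and the innovations $\varepsilon_i$ are random elements of $L^2[0,1]$ with mean zero ($\mu$ is the baseline mean function). Assumption (D): (a) there are a measurable space $S$, a measurable function $g\colon S^\infty\to L^2[0,1]$ and iid $S$-valued random elements $(\epsilon_i)_{i\in\mathbb Z}$ such that $\varepsilon_i=g(\epsilon_i,\epsilon_{i-1},\ldots)$ for all $i\in\mathbb Z$; (b) for some $p>2$, $\sum_{\ell=0}^\infty(\mathbb E[\|\varepsilon_i-\varepsilon_{i,\ell}\|^p])^{1/p}<\infty$, where $\varepsilon_{i,\ell}=g(\epsilon_i,\ldots,\epsilon_{i-\ell+1},\epsilon^*_{i,\ell,i-\ell},\epsilon^*_{i,\ell,i-\ell-1},\ldots)$ and the $\epsilon^*_{i,\ell,j}$ are independent copies of $\epsilon_0$, independent of $(\epsilon_i)_{i\in\mathbb Z}$. Test statistic: $S^0_{n,k}=\frac1{\sqrt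 n}\big(\sum_{i=1}^kX_i-\frac kn\sum_{i=1}^nX_i\big)$ and $T_n=\max_{1\le k\le n}\|S^0_{n,k}\|^2$. *)

theory Defs
  imports "HOL-Probability.Probability"
begin

section \<open>The Hilbert space of square-integrable functions on the unit interval\<close>

abbreviation unit_interval :: "real measure"
  where "unit_interval \<equiv> lebesgue_on {0..1}"

definition square_integrable :: "(real \<Rightarrow> real) \<Rightarrow> bool"
  where "square_integrable f \<longleftrightarrow>
    f \<in> borel_measurable unit_interval \<and> integrable unit_interval (\<lambda>t. (f t)\<^sup>2)"

lemma square_integrable_measurable [measurable_dest]:
  "square_integrable f \<Longrightarrow> f \<in> borel_measurable unit_interval"
  by (simp add: square_integrable_def)

lemma finite_measure_unit: "finite_measure unit_interval"
  by (rule finite_measure_lebesgue_on) simp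

lemma emeasure_unit: "emeasure unit_interval (space unit_interval) = 1"
  by (simp add: emeasure_restrict_space)

lemma square_integrable_mult:
  assumes f: "square_integrable f" and g: "square_integrable g"
  shows "integrable unit_interval (\<lambda>t. f t * g t)"
proof (rule Bochner_Integration.integrable_bound)
  show "integrable unit_interval (\<lambda>t. (f t)\<^sup>2 + (g t)\<^sup>2)"
    using f g by (simp add: square_integrable_def)
  show "(\<lambda>t. f t * g t) \<in> borel_measurable unit_interval"
    using f g by (auto simp: square_integrable_def)
  show "AE t in unit_interval. norm (f t * g t) \<le> norm ((f t)\<^sup>2 + (g t)\<^sup>2)"
  proof (rule AE_I2)
    fix t
    have "2 * (\<bar>f t\<bar> * \<bar>g t\<bar>) \<le> \<bar>f t\<bar>\<^sup>2 + \<bar>g t\<bar>\<^sup>2"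
      using sum_squares_bound[of "\<bar>f t\<bar>" "\<bar>g t\<bar>"] by (simp add: mult.assoc)
    moreover have "0 \<le> \<bar>f t\<bar> * \<bar>g t\<bar>" by simp
    ultimately have "\<bar>f t\<bar> * \<bar>g t\<bar> \<le> (f t)\<^sup>2 + (g t)\<^sup>2"
      unfolding power2_abs by linarith
    then show "norm (f t * g t) \<le> norm ((f t)\<^sup>2 + (g t)\<^sup>2)"
      by (simp add: abs_mult)
  qed
qed

lemma square_integrable_zero: "square_integrable (\<lambda>_. 0)"
  by (simp add: square_integrable_def)

lemma square_integrable_scale: "square_integrable f \<Longrightarrow> square_integrable (\<lambda>t. c * f t)"
  by (auto simp: square_integrable_def power_mult_distrib)

lemma square_integrable_minus: "square_integrable f \<Longrightarrow> square_integrable (\<lambda>t. - f t)"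
  by (auto simp: square_integrable_def)

lemma square_integrable_add:
  assumes f: "square_integrable f" and g: "square_integrable g"
  shows "square_integrable (\<lambda>t. f t + g t)"
proof -
  have "integrable unit_interval (\<lambda>t. (f t)\<^sup>2 + (g t)\<^sup>2 + 2 * (f t * g t))"
    using f g square_integrable_mult[OF f g] by (simp add: square_integrable_def)
  then show ?thesis
    using f g by (auto simp: square_integrable_def power2_sum mult.assoc)
qed

lemma square_integrable_diff:
  "square_integrable f \<Longrightarrow> square_integrable g \<Longrightarrow> square_integrable (\<lambda>t. f t - g t)"
  using square_integrable_add[OF _ square_integrable_minus, of f g] by simp

quotient_type L2 = "real \<Rightarrow> real" / partial:
  "\<lambda>f g. square_integrable f \<and> square_integrable g \<and> (AE t in unit_interval. f t = g t)"
proof (rule part_equivpI)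
  show "\<exists>f. square_integrable f \<and> square_integrable f \<and> (AE t in unit_interval. f t = f t)"
    using square_integrable_zero by auto
  show "symp (\<lambda>f g. square_integrable f \<and> square_integrable g \<and>
      (AE t in unit_interval. f t = g t))"
    by (auto simp: symp_def elim: eventually_mono)
  show "transp (\<lambda>f g. square_integrable f \<and> square_integrable g \<and>
      (AE t in unit_interval. f t = g t))"
    unfolding transp_def by (auto elim!: eventually_elim2)
qed

instantiation L2 :: real_vector
begin

lift_definition zero_L2 :: L2 is "\<lambda>_. 0"
  by (simp add: square_integrable_zero)

lift_definition plus_L2 :: "L2 \<Rightarrow> L2 \<Rightarrow> L2" is "\<lambda>f g t. f t + g t"
  by (auto intro: square_integrable_add elim!: eventually_elim2)

lift_definition uminus_L2 :: "L2 \<Rightarrow> L2" is "\<lambda>f t. - f t"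
  by (auto intro: square_integrable_minus elim!: eventually_mono)

lift_definition minus_L2 :: "L2 \<Rightarrow> L2 \<Rightarrow> L2" is "\<lambda>f g t. f t - g t"
  by (auto intro: square_integrable_diff elim!: eventually_elim2)

lift_definition scaleR_L2 :: "real \<Rightarrow> L2 \<Rightarrow> L2" is "\<lambda>c f t. c * f t"
  by (auto intro: square_integrable_scale elim!: eventually_mono)

instance
  by standard
    (transfer; auto intro!: square_integrable_add square_integrable_scale square_integrable_zero
      square_integrable_minus square_integrable_diff simp: algebra_simps)+

end

instantiation L2 :: real_inner
begin

lift_definition inner_L2 :: "L2 \<Rightarrow> L2 \<Rightarrow> real" is "\<lambda>f g. \<integral>t. f t * g t \<partial>unit_interval"
  by (rule integral_cong_AE) (auto simp: square_integrable_def elim!: eventually_elim2)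

definition norm_L2 :: "L2 \<Rightarrow> real" where "norm_L2 x = sqrt (inner x x)"

definition sgn_L2 :: "L2 \<Rightarrow> L2" where "sgn_L2 x = x /\<^sub>R norm x"

definition dist_L2 :: "L2 \<Rightarrow> L2 \<Rightarrow> real" where "dist_L2 x y = norm (x - y)"

definition uniformity_L2 :: "(L2 \<times> L2) filter"
  where "uniformity_L2 = (INF e\<in>{0 <..}. principal {(x, y). dist x y < e})"

definition open_L2 :: "L2 set \<Rightarrow> bool"
  where "open_L2 U \<longleftrightarrow> (\<forall>x\<in>U. eventually (\<lambda>(x', y). x' = x \<longrightarrow> y \<in> U) uniformity)"

instance
proof
  fix x y z :: L2 and r :: real
  show "inner x y = inner y x"
    by transfer (simp add: mult.commute)
  show "inner (x + y) z = inner x z + inner y z"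
    by transfer (simp add: distrib_right square_integrable_mult)
  show "inner (r *\<^sub>R x) y = r * inner x y"
    by transfer (simp add: mult.assoc)
  show "0 \<le> inner x x"
    by transfer simp
  show "inner x x = 0 \<longleftrightarrow> x = 0"
  proof transfer
    fix f :: "real \<Rightarrow> real"
    assume "square_integrable f \<and> square_integrable f \<and> (AE t in unit_interval. f t = f t)"
    then have f: "square_integrable f" by simp
    have "(\<integral>t. f t * f t \<partial>unit_interval) = 0 \<longleftrightarrow> (AE t in unit_interval. f t * f t = 0)"
      by (rule integral_nonneg_eq_0_iff_AE) (simp_all add: square_integrable_mult f)
    then show "(\<integral>t. f t * f t \<partial>unit_interval) = 0 \<longleftrightarrow>
        (square_integrable f \<and> square_integrable (\<lambda>_. 0) \<and> (AE t in unit_interval. f t = 0))"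
      by (simp add: f square_integrable_zero)
  qed
qed (simp_all add: norm_L2_def sgn_L2_def dist_L2_def uniformity_L2_def open_L2_def)

end

lemma norm_L2_eq:
  "square_integrable f \<Longrightarrow> norm (abs_L2 f) = sqrt (\<integral>t. (f t)\<^sup>2 \<partial>unit_interval)"
  by (simp add: norm_L2_def inner_L2.abs_eq power2_eq_square)


subsection \<open>Completeness\<close>

lemma abs_rep_L2: "abs_L2 (rep_L2 x) = x"
  by (rule Quotient3_abs_rep[OF Quotient3_L2])

lemma square_integrable_rep_L2: "square_integrable (rep_L2 x)"
  using Quotient3_rep_reflp[OF Quotient3_L2, of x] by simp

lemma abs_L2_eqI:
  assumes "square_integrable f" "square_integrable g" "AE t in unit_interval. f t = g t"
  shows "abs_L2 f = abs_L2 g"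
  using Quotient3_rel[OF Quotient3_L2, of f g] assms by simp

lemma diff_rep_L2: "x - y = abs_L2 (\<lambda>t. rep_L2 x t - rep_L2 y t)"
  by (metis abs_rep_L2 minus_L2.abs_eq square_integrable_rep_L2 eventually_True AE_I2)

lemma square_integrable_norm_nn_integral:
  assumes f: "f \<in> borel_measurable unit_interval" and C: "0 \<le> C"
    and le: "(\<integral>\<^sup>+t. ennreal ((f t)\<^sup>2) \<partial>unit_interval) \<le> ennreal (C\<^sup>2)"
  shows "square_integrable f" "norm (abs_L2 f) \<le> C"
proof -
  have "integrable unit_interval (\<lambda>t. (f t)\<^sup>2)"
    using f le by (intro integrableI_bounded) (auto simp: le_less_trans)
  then show sq: "square_integrable f"
    using f by (simp add: square_integrable_def)
  have "ennreal (\<integral>t. (f t)\<^sup>2 \<partial>unit_interval) = (\<integral>\<^sup>+t. ennreal ((f t)\<^sup>2) \<partial>unit_interval)"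
    using sq by (intro nn_integral_eq_integral[symmetric]) (auto simp: square_integrable_def)
  then have "(\<integral>t. (f t)\<^sup>2 \<partial>unit_interval) \<le> C\<^sup>2"
    using le by (metis ennreal_le_iff zero_le_power2)
  then show "norm (abs_L2 f) \<le> C"
    using C by (simp add: norm_L2_eq[OF sq] real_le_lsqrt)
qed

lemma nn_integral_square_eq_norm:
  assumes "square_integrable f"
  shows "(\<integral>\<^sup>+t. ennreal ((f t)\<^sup>2) \<partial>unit_interval) = ennreal ((norm (abs_L2 f))\<^sup>2)"
proof -
  have "(\<integral>\<^sup>+t. ennreal ((f t)\<^sup>2) \<partial>unit_interval) = ennreal (\<integral>t. (f t)\<^sup>2 \<partial>unit_interval)"
    using assms by (intro nn_integral_eq_integral) (auto simp: square_integrable_def)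
  then show ?thesis
    by (simp add: norm_L2_eq[OF assms])
qed

lemma square_integrable_bounded:
  assumes f: "f \<in> borel_measurable unit_interval" and g: "square_integrable g"
    and le: "AE t in unit_interval. \<bar>f t\<bar> \<le> \<bar>g t\<bar>"
  shows "square_integrable f"
proof -
  have "integrable unit_interval (\<lambda>t. (f t)\<^sup>2)"
  proof (rule Bochner_Integration.integrable_bound)
    show "integrable unit_interval (\<lambda>t. (g t)\<^sup>2)"
      using g by (simp add: square_integrable_def)
    show "AE t in unit_interval. norm ((f t)\<^sup>2) \<le> norm ((g t)\<^sup>2)"
      using le by eventually_elim (simp add: abs_le_square_iff)
  qed (use f in simp)
  then show ?thesis using f by (simp add: square_integrable_def)
qed

lemma square_integrable_const: "square_integrable (\<lambda>_. c)"
  using finite_measure.integrable_const[OF finite_measure_unit] by (simp add: square_integrable_def)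

lemma integral_abs_le_norm_L2:
  assumes f: "square_integrable f"
  shows "(\<integral>\<^sup>+t. ennreal \<bar>f t\<bar> \<partial>unit_interval) \<le> ennreal (norm (abs_L2 f))"
proof -
  have a: "square_integrable (\<lambda>t. \<bar>f t\<bar>)"
    using f by (intro square_integrable_bounded[OF _ f]) (auto simp: square_integrable_def)
  have one: "square_integrable (\<lambda>_. 1)" by (rule square_integrable_const)
  have n1: "norm (abs_L2 (\<lambda>_. 1)) = 1"
    using emeasure_unit by (simp add: norm_L2_eq[OF one] measure_def)
  have na: "norm (abs_L2 (\<lambda>t. \<bar>f t\<bar>)) = norm (abs_L2 f)"
    by (simp add: norm_L2_eq a f)
  have int: "integrable unit_interval (\<lambda>t. \<bar>f t\<bar>)"
    using square_integrable_mult[OF a one] by simp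
  have "(\<integral>t. \<bar>f t\<bar> \<partial>unit_interval) = inner (abs_L2 (\<lambda>t. \<bar>f t\<bar>)) (abs_L2 (\<lambda>_. 1))"
    by (simp add: inner_L2.abs_eq a one)
  also have "\<dots> \<le> norm (abs_L2 (\<lambda>t. \<bar>f t\<bar>)) * norm (abs_L2 (\<lambda>_. 1))"
    by (rule norm_cauchy_schwarz)
  finally have "(\<integral>t. \<bar>f t\<bar> \<partial>unit_interval) \<le> norm (abs_L2 f)"
    by (simp add: n1 na)
  then show ?thesis
    using int by (simp add: nn_integral_eq_integral ennreal_leI)
qed

instance L2 :: complete_space
proof
  fix X :: "nat \<Rightarrow> L2"
  assume X: "Cauchy X"
  have ex: "\<exists>N. \<forall>m\<ge>N. \<forall>n\<ge>N. norm (X m - X n) < (1/2)^k" for k :: nat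
    using X by (simp add: Cauchy_def dist_norm)
  obtain r where r: "\<And>k. \<forall>m\<ge>r k. \<forall>n\<ge>r k. norm (X m - X n) < (1/2)^k" "\<And>k. r k \<le> r (Suc k)"
  proof -
    have "\<exists>r. \<forall>k. (\<forall>m\<ge>r k. \<forall>n\<ge>r k. norm (X m - X n) < (1/2)^k) \<and> r k \<le> r (Suc k)"
    proof (rule dependent_nat_choice)
      show "\<exists>N. \<forall>m\<ge>N. \<forall>n\<ge>N. norm (X m - X n) < (1/2)^0" by (rule ex)
    next
      fix N k
      obtain M where "\<forall>m\<ge>M. \<forall>n\<ge>M. norm (X m - X n) < (1/2)^Suc k" using ex by blast
      then show "\<exists>y. (\<forall>m\<ge>y. \<forall>n\<ge>y. norm (X m - X n) < (1/2)^Suc k) \<and> N \<le> y"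
        by (intro exI[of _ "max M N"]) simp
    qed
    then show ?thesis using that by blast
  qed
  have r_mono: "r k \<le> r m" if "k \<le> m" for k m
    using lift_Suc_mono_le[of r, OF r(2) that] .
  define f where "f k = rep_L2 (X (r k))" for k
  have f: "square_integrable (f k)" for k
    by (simp add: f_def square_integrable_rep_L2)
  have fm [measurable]: "f k \<in> borel_measurable unit_interval" for k
    using f by (simp add: square_integrable_def)
  have fX: "abs_L2 (\<lambda>t. f m t - f k t) = X (r m) - X (r k)" for m k
    by (simp add: f_def diff_rep_L2)
  have bound: "norm (abs_L2 (\<lambda>t. f m t - f k t)) \<le> (1/2)^k" if "k \<le> m" for m k
    using r(1)[of k] r_mono[OF that] by (auto simp: fX intro: less_imp_le)
  have "(\<integral>\<^sup>+t. (\<Sum>k. ennreal \<bar>f (Suc k) t - f k t\<bar>) \<partial>unit_interval)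
      = (\<Sum>k. \<integral>\<^sup>+t. ennreal \<bar>f (Suc k) t - f k t\<bar> \<partial>unit_interval)"
    by (rule nn_integral_suminf) simp
  also have "\<dots> \<le> (\<Sum>k. ennreal ((1/2)^k))"
  proof (intro suminf_le allI)
    fix k
    show "(\<integral>\<^sup>+t. ennreal \<bar>f (Suc k) t - f k t\<bar> \<partial>unit_interval) \<le> ennreal ((1/2)^k)"
      by (rule order_trans[OF integral_abs_le_norm_L2[OF square_integrable_diff[OF f f]]
          ennreal_leI[OF bound]]) simp
  qed (rule summableI)+
  also have "\<dots> = ennreal (\<Sum>k. (1/2)^k)"
    by (rule suminf_ennreal2) (simp_all add: summable_geometric)
  finally have "AE t in unit_interval. (\<Sum>k. ennreal \<bar>f (Suc k) t - f k t\<bar>) \<noteq> \<infinity>"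
    by (intro nn_integral_PInf_AE) (auto simp: top_unique)
  then have conv: "AE t in unit_interval. convergent (\<lambda>k. f k t)"
  proof eventually_elim
    fix t assume "(\<Sum>k. ennreal \<bar>f (Suc k) t - f k t\<bar>) \<noteq> \<infinity>"
    then have "summable (\<lambda>k. \<bar>f (Suc k) t - f k t\<bar>)"
      unfolding infinity_ennreal_def by (rule summable_suminf_not_top[OF abs_ge_zero])
    then have "summable (\<lambda>k. f (Suc k) t - f k t)"
      by (rule summable_rabs_cancel)
    then have "(\<lambda>n. f 0 t + (\<Sum>k<n. f (Suc k) t - f k t)) \<longlonglongrightarrow> f 0 t + (\<Sum>k. f (Suc k) t - f k t)"
      by (intro tendsto_intros summable_LIMSEQ)
    moreover have "f 0 t + (\<Sum>k<n. f (Suc k) t - f k t) = f n t" for n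
      by (simp only: sum_lessThan_telescope[of "\<lambda>k. f k t" n] add_diff_cancel_left' add.commute[of "f 0 t"] diff_add_cancel)
    ultimately have "(\<lambda>n. f n t) \<longlonglongrightarrow> f 0 t + (\<Sum>k. f (Suc k) t - f k t)"
      by (simp only:)
    then show "convergent (\<lambda>k. f k t)"
      by (rule convergentI)
  qed
  define F where "F t = lim (\<lambda>k. f k t)" for t
  have Fm [measurable]: "F \<in> borel_measurable unit_interval"
    unfolding F_def by (rule borel_measurable_lim_metric) simp
  have lim: "AE t in unit_interval. (\<lambda>k. f k t) \<longlonglongrightarrow> F t"
    using conv by eventually_elim (simp add: F_def convergent_LIMSEQ_iff)
  have *: "square_integrable (\<lambda>t. F t - f k t) \<and> norm (abs_L2 (\<lambda>t. F t - f k t)) \<le> (1/2)^k" for k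
  proof -
    have "(\<integral>\<^sup>+t. ennreal ((F t - f k t)\<^sup>2) \<partial>unit_interval)
        = (\<integral>\<^sup>+t. liminf (\<lambda>m. ennreal ((f m t - f k t)\<^sup>2)) \<partial>unit_interval)"
    proof (rule nn_integral_cong_AE)
      show "AE t in unit_interval. ennreal ((F t - f k t)\<^sup>2)
          = liminf (\<lambda>m. ennreal ((f m t - f k t)\<^sup>2))"
        using lim
      proof eventually_elim
        fix t assume "(\<lambda>k. f k t) \<longlonglongrightarrow> F t"
        then have "(\<lambda>m. ennreal ((f m t - f k t)\<^sup>2)) \<longlonglongrightarrow> ennreal ((F t - f k t)\<^sup>2)"
          by (intro tendsto_intros)
        then show "ennreal ((F t - f k t)\<^sup>2) = liminf (\<lambda>m. ennreal ((f m t - f k t)\<^sup>2))"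
          by (rule lim_imp_Liminf[OF sequentially_bot, symmetric])
      qed
    qed
    also have "\<dots> \<le> liminf (\<lambda>m. \<integral>\<^sup>+t. ennreal ((f m t - f k t)\<^sup>2) \<partial>unit_interval)"
      by (rule nn_integral_liminf) simp
    also have "\<dots> \<le> ennreal (((1/2)^k)\<^sup>2)"
    proof (rule Liminf_le)
      show "\<forall>\<^sub>F m in sequentially.
          (\<integral>\<^sup>+t. ennreal ((f m t - f k t)\<^sup>2) \<partial>unit_interval) \<le> ennreal (((1/2)^k)\<^sup>2)"
        using eventually_ge_at_top[of k]
      proof eventually_elim
        fix m assume "k \<le> m"
        then show "(\<integral>\<^sup>+t. ennreal ((f m t - f k t)\<^sup>2) \<partial>unit_interval) \<le> ennreal (((1/2)^k)\<^sup>2)"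
          unfolding nn_integral_square_eq_norm[OF square_integrable_diff[OF f f]]
          by (intro ennreal_leI power_mono bound) auto
      qed
    qed simp
    finally show ?thesis
      using square_integrable_norm_nn_integral[of "\<lambda>t. F t - f k t" "(1/2)^k"] by simp
  qed
  have F: "square_integrable F"
    using square_integrable_add[OF conjunct1[OF *[of 0]] f[of 0]] by simp
  have F_X: "norm (abs_L2 F - X (r k)) \<le> (1/2)^k" for k
  proof -
    have "abs_L2 F - X (r k) = abs_L2 F - abs_L2 (f k)"
      by (simp add: f_def abs_rep_L2)
    also have "\<dots> = abs_L2 (\<lambda>t. F t - f k t)"
      by (rule minus_L2.abs_eq) (simp_all add: F f)
    finally show ?thesis using * by simp
  qed
  have "X \<longlonglongrightarrow> abs_L2 F"
  proof (rule metric_LIMSEQ_I)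
    fix e :: real assume "0 < e"
    then obtain k where k: "(1/2)^k < e / 2"
      using real_arch_pow_inv[of "e/2" "1/2"] by auto
    have "dist (X n) (abs_L2 F) < e" if "r k \<le> n" for n
    proof -
      have "norm (X n - abs_L2 F) \<le> norm (X n - X (r k)) + norm (X (r k) - abs_L2 F)"
        using norm_triangle_ineq[of "X n - X (r k)" "X (r k) - abs_L2 F"] by simp
      moreover have "norm (X n - X (r k)) < (1/2)^k" using r(1)[of k] that by auto
      moreover have "norm (X (r k) - abs_L2 F) \<le> (1/2)^k" using F_X[of k] by (simp add: norm_minus_commute)
      ultimately show ?thesis using k by (simp add: dist_norm)
    qed
    then show "\<exists>N. \<forall>n\<ge>N. dist (X n) (abs_L2 F) < e" by blast
  qed
  then show "convergent X" by (auto simp: convergent_def)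
qed

instance L2 :: banach ..


subsection \<open>Separability\<close>

lemma L2_dominated_convergence:
  assumes f: "\<And>n. f n \<in> borel_measurable unit_interval" and F: "F \<in> borel_measurable unit_interval"
    and w: "square_integrable w" and le: "\<And>n. AE t in unit_interval. \<bar>f n t\<bar> \<le> \<bar>w t\<bar>"
    and lim: "AE t in unit_interval. (\<lambda>n. f n t) \<longlonglongrightarrow> F t"
  shows "(\<lambda>n. abs_L2 (f n)) \<longlonglongrightarrow> abs_L2 F"
proof -
  have sq_f: "square_integrable (f n)" for n
    by (rule square_integrable_bounded[OF f w le])
  have all: "AE t in unit_interval. \<forall>n. \<bar>f n t\<bar> \<le> \<bar>w t\<bar>"
    using le by (simp add: AE_all_countable)
  have "AE t in unit_interval. \<bar>F t\<bar> \<le> \<bar>w t\<bar>"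
    using all lim
  proof eventually_elim
    fix t assume "\<forall>n. \<bar>f n t\<bar> \<le> \<bar>w t\<bar>" "(\<lambda>n. f n t) \<longlonglongrightarrow> F t"
    then show "\<bar>F t\<bar> \<le> \<bar>w t\<bar>"
      by (intro LIMSEQ_le_const2[OF tendsto_rabs]) auto
  qed
  then have sq_F: "square_integrable F"
    by (rule square_integrable_bounded[OF F w])
  have "(\<lambda>n. \<integral>t. (f n t - F t)\<^sup>2 \<partial>unit_interval) \<longlonglongrightarrow> (\<integral>t. 0 \<partial>unit_interval)"
  proof (rule integral_dominated_convergence[where w = "\<lambda>t. (2 * \<bar>w t\<bar>)\<^sup>2"])
    show "integrable unit_interval (\<lambda>t. (2 * \<bar>w t\<bar>)\<^sup>2)"
      using w by (simp add: square_integrable_def power_mult_distrib)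
    show "AE t in unit_interval. (\<lambda>n. (f n t - F t)\<^sup>2) \<longlonglongrightarrow> 0"
      using lim
    proof eventually_elim
      fix t assume "(\<lambda>n. f n t) \<longlonglongrightarrow> F t"
      then have "(\<lambda>n. (f n t - F t)\<^sup>2) \<longlonglongrightarrow> (F t - F t)\<^sup>2"
        by (intro tendsto_intros)
      then show "(\<lambda>n. (f n t - F t)\<^sup>2) \<longlonglongrightarrow> 0" by simp
    qed
    fix n
    show "AE t in unit_interval. norm ((f n t - F t)\<^sup>2) \<le> (2 * \<bar>w t\<bar>)\<^sup>2"
      using all \<open>AE t in unit_interval. \<bar>F t\<bar> \<le> \<bar>w t\<bar>\<close>
    proof eventually_elim
      fix t assume a: "\<forall>n. \<bar>f n t\<bar> \<le> \<bar>w t\<bar>" "\<bar>F t\<bar> \<le> \<bar>w t\<bar>"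
      have "\<bar>f n t - F t\<bar> \<le> 2 * \<bar>w t\<bar>"
        using a(1)[rule_format, of n] a(2) by linarith
      then have "\<bar>f n t - F t\<bar>\<^sup>2 \<le> (2 * \<bar>w t\<bar>)\<^sup>2" by (rule power_mono) simp
      then show "norm ((f n t - F t)\<^sup>2) \<le> (2 * \<bar>w t\<bar>)\<^sup>2" by simp
    qed
  qed (use f F in simp_all)
  then have "(\<lambda>n. sqrt (\<integral>t. (f n t - F t)\<^sup>2 \<partial>unit_interval)) \<longlonglongrightarrow> sqrt 0"
    by (intro tendsto_real_sqrt) simp
  moreover have "sqrt (\<integral>t. (f n t - F t)\<^sup>2 \<partial>unit_interval) = norm (abs_L2 (f n) - abs_L2 F)" for n
  proof -
    have "abs_L2 (f n) - abs_L2 F = abs_L2 (\<lambda>t. f n t - F t)"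
      by (rule minus_L2.abs_eq) (simp_all add: sq_f sq_F)
    then show ?thesis
      by (simp add: norm_L2_eq square_integrable_diff sq_f sq_F)
  qed
  ultimately have "(\<lambda>n. norm (abs_L2 (f n) - abs_L2 F)) \<longlonglongrightarrow> 0"
    by (simp only: real_sqrt_zero)
  then show ?thesis
    by (simp only: tendsto_norm_zero_iff LIM_zero_iff)
qed

(* Rational linear combinations of indicators of rational half-lines: a countable dense set. *)
definition rat_comb :: "(rat \<times> rat) list \<Rightarrow> L2"
  where "rat_comb l = (\<Sum>(q, a) \<leftarrow> l. real_of_rat q *\<^sub>R abs_L2 (indicator {..real_of_rat a}))"

lemma closure_limI:
  fixes x :: "'a::first_countable_topology"
  assumes "\<And>n::nat. u n \<in> A" "u \<longlonglongrightarrow> x"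
  shows "x \<in> closure A"
  unfolding closure_sequential using assms by (intro exI[of _ u]) simp

lemma closure_rat_comb_add:
  assumes "x \<in> closure (range rat_comb)" "y \<in> closure (range rat_comb)"
  shows "x + y \<in> closure (range rat_comb)"
proof -
  obtain u v where u: "\<And>n::nat. u n \<in> range rat_comb" "u \<longlonglongrightarrow> x"
    and v: "\<And>n::nat. v n \<in> range rat_comb" "v \<longlonglongrightarrow> y"
    using assms unfolding closure_sequential by metis
  have "u n + v n \<in> range rat_comb" for n
  proof -
    obtain l k where "u n = rat_comb l" "v n = rat_comb k"
      using u(1)[of n] v(1)[of n] by blast
    then have "u n + v n = rat_comb (l @ k)" by (simp add: rat_comb_def)
    then show ?thesis by blast
  qed
  moreover have "(\<lambda>n. u n + v n) \<longlonglongrightarrow> x + y"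
    by (intro tendsto_intros u v)
  ultimately show ?thesis by (rule closure_limI)
qed

lemma closure_rat_comb_scaleR:
  assumes "x \<in> closure (range rat_comb)"
  shows "c *\<^sub>R x \<in> closure (range rat_comb)"
proof -
  obtain u where u: "\<And>n::nat. u n \<in> range rat_comb" "u \<longlonglongrightarrow> x"
    using assms unfolding closure_sequential by metis
  have "c \<in> closure \<rat>" by (simp add: Rats_closure_real)
  then obtain p where p: "\<And>n::nat. p n \<in> \<rat>" "p \<longlonglongrightarrow> c"
    unfolding closure_sequential by metis
  have "p n *\<^sub>R u n \<in> range rat_comb" for n
  proof -
    obtain l q where l: "u n = rat_comb l" and q: "p n = real_of_rat q"
      using u(1)[of n] p(1)[of n] by (auto elim: Rats_cases)
    have "real_of_rat q *\<^sub>R rat_comb l = rat_comb (map (\<lambda>(r, a). (q * r, a)) l)"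
      by (induction l) (auto simp: rat_comb_def of_rat_mult scaleR_add_right)
    then show ?thesis using l q by auto
  qed
  moreover have "(\<lambda>n. p n *\<^sub>R u n) \<longlonglongrightarrow> c *\<^sub>R x"
    by (intro tendsto_intros u p)
  ultimately show ?thesis by (rule closure_limI)
qed

lemma closure_rat_comb_zero: "0 \<in> closure (range rat_comb)"
proof -
  have "rat_comb [] = 0" by (simp add: rat_comb_def)
  then have "0 \<in> range rat_comb" by (metis rangeI)
  then show ?thesis by (rule closure_subset[THEN subsetD])
qed

lemma closure_rat_comb_diff:
  assumes "x \<in> closure (range rat_comb)" "y \<in> closure (range rat_comb)"
  shows "x - y \<in> closure (range rat_comb)"
  using closure_rat_comb_add[OF assms(1) closure_rat_comb_scaleR[OF assms(2), of "-1"]] by simp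

lemma closure_rat_comb_lim:
  assumes "\<And>n::nat. u n \<in> closure (range rat_comb)" "u \<longlonglongrightarrow> x"
  shows "x \<in> closure (range rat_comb)"
  using closed_sequentially[OF closed_closure assms] .

lemma borel_measurable_unit: "f \<in> borel_measurable borel \<Longrightarrow> f \<in> borel_measurable unit_interval"
  for f :: "real \<Rightarrow> real"
  by (intro measurable_restrict_space1 measurable_completion) simp

lemma square_integrable_indicator:
  "indicat_real A \<in> borel_measurable unit_interval \<Longrightarrow> square_integrable (indicator A)"
  by (rule square_integrable_bounded[OF _ square_integrable_const[of 1]]) (auto simp: indicator_def)

lemma closure_rat_comb_atMost: "abs_L2 (indicator {..a}) \<in> closure (range rat_comb)"
proof -
  have "\<exists>q. a < real_of_rat q \<and> real_of_rat q < a + inverse (real (Suc n))" for n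
    using of_rat_dense[of a "a + inverse (real (Suc n))"] by simp
  then obtain q where q: "\<And>n. a < real_of_rat (q n)" "\<And>n. real_of_rat (q n) < a + inverse (real (Suc n))"
    by metis
  have mem: "abs_L2 (indicator {..real_of_rat (q n)}) \<in> closure (range rat_comb)" for n
  proof -
    have "abs_L2 (indicator {..real_of_rat (q n)}) = rat_comb [(1, q n)]"
      by (simp add: rat_comb_def)
    then have "abs_L2 (indicator {..real_of_rat (q n)}) \<in> range rat_comb" by (metis rangeI)
    then show ?thesis by (rule closure_subset[THEN subsetD])
  qed
  have q_lim: "(\<lambda>n. real_of_rat (q n)) \<longlonglongrightarrow> a"
  proof (rule tendsto_sandwich[where f = "\<lambda>_. a" and h = "\<lambda>n. a + inverse (real (Suc n))"])
    show "(\<lambda>n. a + inverse (real (Suc n))) \<longlonglongrightarrow> a"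
      using tendsto_add[OF tendsto_const LIMSEQ_inverse_real_of_nat, of a] by simp
    show "\<forall>\<^sub>F n in sequentially. a \<le> real_of_rat (q n)"
      using q(1) by (intro always_eventually allI less_imp_le)
    show "\<forall>\<^sub>F n in sequentially. real_of_rat (q n) \<le> a + inverse (real (Suc n))"
      using q(2) by (intro always_eventually allI less_imp_le)
  qed (rule tendsto_const)
  have lim: "(\<lambda>n. abs_L2 (indicator {..real_of_rat (q n)})) \<longlonglongrightarrow> abs_L2 (indicator {..a})"
  proof (rule L2_dominated_convergence[OF _ _ square_integrable_const[of 1]])
    show "AE t in unit_interval. (\<lambda>n. indicator {..real_of_rat (q n)} t) \<longlonglongrightarrow> (indicator {..a} t :: real)"
    proof (rule AE_I2)
      fix t
      have "\<forall>\<^sub>F n in sequentially. indicator {..real_of_rat (q n)} t = (indicator {..a} t :: real)"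
      proof (cases "t \<le> a")
        case True
        then have "t \<le> real_of_rat (q n)" for n using q(1)[of n] by linarith
        then show ?thesis using True by (simp add: indicator_def)
      next
        case False
        then have "\<forall>\<^sub>F n in sequentially. real_of_rat (q n) < t"
          using q_lim by (auto intro: order_tendstoD)
        then show ?thesis using False by (auto simp: indicator_def elim!: eventually_mono)
      qed
      then show "(\<lambda>n. indicator {..real_of_rat (q n)} t) \<longlonglongrightarrow> (indicator {..a} t :: real)"
        by (rule tendsto_eventually)
    qed
    show "indicat_real {..real_of_rat (q n)} \<in> borel_measurable unit_interval" for n
      by (intro borel_measurable_unit borel_measurable_indicator) simp
    show "indicat_real {..a} \<in> borel_measurable unit_interval"
      by (intro borel_measurable_unit borel_measurable_indicator) simp
  qed (simp add: indicator_def)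
  show ?thesis by (rule closure_rat_comb_lim[OF mem lim])
qed

lemma closure_rat_comb_borel:
  assumes "A \<in> sets borel"
  shows "abs_L2 (indicator A) \<in> closure (range rat_comb)"
proof -
  let ?G = "range (\<lambda>a::real. {..a})"
  have eq: "sigma_sets UNIV ?G = sets borel"
    by (simp add: borel_eq_atMost)
  have A: "A \<in> sigma_sets UNIV ?G" using assms eq by simp
  have Int: "Int_stable ?G" by (auto simp: Int_stable_def)
  have sq: "square_integrable (indicator B)" if "B \<in> sets borel" for B :: "real set"
    using that by (intro square_integrable_indicator borel_measurable_unit) simp
  have one: "abs_L2 (\<lambda>_. 1) \<in> closure (range rat_comb)"
  proof -
    have "abs_L2 (\<lambda>_. 1) = abs_L2 (indicator {..1})"
      using sq[of "{..1}"] square_integrable_const[of 1]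
      by (intro abs_L2_eqI) (auto intro!: AE_I2)
    then show ?thesis by (simp add: closure_rat_comb_atMost)
  qed
  have sub: "?G \<subseteq> Pow UNIV" by simp
  from Int sub A show ?thesis
  proof (induction rule: sigma_sets_induct_disjoint[of ?G UNIV])
    case (basic A)
    then show ?case using closure_rat_comb_atMost by auto
  next
    case empty
    show ?case using closure_rat_comb_zero by (simp add: zero_L2_def indicator_def[abs_def])
  next
    case (compl A)
    have "abs_L2 (\<lambda>_. 1) - abs_L2 (indicator A) = abs_L2 (\<lambda>t. 1 - indicator A t)"
      using compl.hyps by (intro minus_L2.abs_eq) (simp_all add: square_integrable_const sq eq)
    also have "(\<lambda>t. 1 - indicator A t) = (indicator (UNIV - A) :: real \<Rightarrow> real)"
      by (auto simp: indicator_def)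
    finally show ?case using closure_rat_comb_diff[OF one compl.IH] by simp
  next
    case (union A)
    then have A: "A i \<in> sets borel" for i using eq by auto
    have part: "abs_L2 (indicator (\<Union>i<n. A i)) \<in> closure (range rat_comb)" for n
    proof (induction n)
      case 0
      show ?case using closure_rat_comb_zero by (simp add: zero_L2_def indicator_def[abs_def])
    next
      case (Suc n)
      have "A n \<inter> A i = {}" if "i < n" for i
        using union.hyps(1) that by (intro disjoint_family_onD[of A UNIV]) simp_all
      then have "A n \<inter> (\<Union>i<n. A i) = {}" by blast
      then have "indicat_real (A n \<union> (\<Union>i<n. A i)) t
          = indicator (A n) t + indicator (\<Union>i<n. A i) t" for t
        by (rule indicator_disj_union)
      then have eq_sum: "indicat_real (\<Union>i<Suc n. A i)
          = (\<lambda>t. indicator (\<Union>i<n. A i) t + indicator (A n) t)"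
        by (simp add: lessThan_Suc fun_eq_iff add.commute)
      have U: "(\<Union>i<n. A i) \<in> sets borel"
        using A by (intro sets.finite_UN) simp_all
      have "abs_L2 (indicator (\<Union>i<n. A i)) + abs_L2 (indicator (A n))
          = abs_L2 (\<lambda>t. indicator (\<Union>i<n. A i) t + indicator (A n) t)"
        by (rule plus_L2.abs_eq) (simp_all add: sq U A)
      then show ?case
        using closure_rat_comb_add[OF Suc union.IH[of n]] by (simp only: eq_sum)
    qed
    show ?case
    proof (rule closure_rat_comb_lim[OF part])
      show "(\<lambda>n. abs_L2 (indicator (\<Union>i<n. A i))) \<longlonglongrightarrow> abs_L2 (indicator (\<Union>i. A i))"
      proof (rule L2_dominated_convergence[OF _ _ square_integrable_const[of 1]])
        show "AE t in unit_interval.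
            (\<lambda>n. indicator (\<Union>i<n. A i) t) \<longlonglongrightarrow> (indicator (\<Union>i. A i) t :: real)"
          by (intro AE_I2 LIMSEQ_indicator_UN)
        show "indicat_real (\<Union>i<n. A i) \<in> borel_measurable unit_interval" for n
          using A by (intro borel_measurable_unit[OF borel_measurable_indicator]) simp_all
        show "indicat_real (\<Union>i. A i) \<in> borel_measurable unit_interval"
          using A by (intro borel_measurable_unit[OF borel_measurable_indicator]) simp_all
      qed (auto simp: indicator_def)
    qed
  qed
qed

lemma closure_rat_comb_lebesgue:
  assumes A: "A \<in> sets unit_interval"
  shows "abs_L2 (indicator A) \<in> closure (range rat_comb)"
proof -
  have "A \<in> sets lebesgue"
    using A by (auto simp: sets_restrict_space)
  then obtain S N N' where *: "A = S \<union> N" "N \<subseteq> N'" "N' \<in> null_sets lborel" "S \<in> sets lborel"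
    by (rule sets_completionE)
  have "AE t in lebesgue. t \<notin> N'"
    using *(3) by (intro AE_completion AE_not_in)
  then have "AE t in unit_interval. indicator A t = (indicator S t :: real)"
    by (subst AE_restrict_space_iff) (use * in \<open>auto simp: indicator_def elim!: eventually_mono\<close>)
  moreover have "square_integrable (indicator A)"
    using A by (intro square_integrable_indicator) simp
  moreover have "square_integrable (indicator S)"
    using * by (intro square_integrable_indicator borel_measurable_unit) simp
  ultimately have "abs_L2 (indicator A) = abs_L2 (indicator S)"
    by (intro abs_L2_eqI)
  then show ?thesis using * closure_rat_comb_borel[of S] by simp
qed

lemma closure_rat_comb: "closure (range rat_comb) = UNIV"
proof -
  have "abs_L2 f \<in> closure (range rat_comb)" if f: "square_integrable f" for f
  proof -
    have fm: "f \<in> borel_measurable unit_interval" using f by (simp add: square_integrable_def)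
    from borel_measurable_implies_sequence_metric[OF fm, of 0] obtain s where
      s: "\<And>i. simple_function unit_interval (s i)"
        "\<And>t. t \<in> space unit_interval \<Longrightarrow> (\<lambda>i. s i t) \<longlonglongrightarrow> f t"
        "\<And>i t. t \<in> space unit_interval \<Longrightarrow> norm (s i t) \<le> 2 * norm (f t)"
      by (simp only: dist_norm diff_0_right) metis
    have "abs_L2 (s i) \<in> closure (range rat_comb)" for i
    proof -
      let ?B = "\<lambda>y. s i -` {y} \<inter> space unit_interval"
      have B: "?B y \<in> sets unit_interval" for y
        using s(1)[of i] by (rule simple_functionD)
      have B_sq: "square_integrable (\<lambda>t. indicator (?B y) t *\<^sub>R y)" for y
        using square_integrable_scale[OF square_integrable_indicator[of "?B y"], of y] B[of y]
        by (simp add: mult.commute)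
      have sum: "square_integrable (\<lambda>t. \<Sum>y\<in>Y. indicator (?B y) t *\<^sub>R y) \<and>
          abs_L2 (\<lambda>t. \<Sum>y\<in>Y. indicator (?B y) t *\<^sub>R y) \<in> closure (range rat_comb)"
        if "finite Y" for Y
        using that
      proof (induction Y rule: finite_induct)
        case empty
        show ?case
          using closure_rat_comb_zero by (simp add: square_integrable_zero zero_L2.abs_eq)
      next
        case (insert y Y)
        have "abs_L2 (\<lambda>t. indicator (?B y) t *\<^sub>R y) = y *\<^sub>R abs_L2 (indicator (?B y))"
          using B[of y] by (subst scaleR_L2.abs_eq) (auto intro!: square_integrable_indicator simp: mult.commute)
        then have "abs_L2 (\<lambda>t. indicator (?B y) t *\<^sub>R y) \<in> closure (range rat_comb)"
          using closure_rat_comb_scaleR[OF closure_rat_comb_lebesgue[OF B]] by simp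
        then have "abs_L2 (\<lambda>t. indicator (?B y) t *\<^sub>R y) + abs_L2 (\<lambda>t. \<Sum>y\<in>Y. indicator (?B y) t *\<^sub>R y)
            \<in> closure (range rat_comb)"
          by (rule closure_rat_comb_add[OF _ conjunct2[OF insert.IH]])
        moreover have "abs_L2 (\<lambda>t. indicator (?B y) t *\<^sub>R y) + abs_L2 (\<lambda>t. \<Sum>y\<in>Y. indicator (?B y) t *\<^sub>R y)
            = abs_L2 (\<lambda>t. indicator (?B y) t *\<^sub>R y + (\<Sum>y\<in>Y. indicator (?B y) t *\<^sub>R y))"
          by (rule plus_L2.abs_eq) (use insert.IH B_sq in auto)
        ultimately have "abs_L2 (\<lambda>t. indicator (?B y) t *\<^sub>R y + (\<Sum>y\<in>Y. indicator (?B y) t *\<^sub>R y))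
            \<in> closure (range rat_comb)"
          by (simp only:)
        moreover have "square_integrable (\<lambda>t. indicator (?B y) t *\<^sub>R y + (\<Sum>y\<in>Y. indicator (?B y) t *\<^sub>R y))"
          by (rule square_integrable_add[OF B_sq]) (use insert.IH in blast)
        ultimately show ?case
          by (simp only: sum.insert[OF insert.hyps])
      qed
      let ?g = "\<lambda>t. \<Sum>y\<in>s i ` space unit_interval. indicator (?B y) t *\<^sub>R y"
      have g: "square_integrable ?g" "abs_L2 ?g \<in> closure (range rat_comb)"
        using sum[OF simple_functionD(1)[OF s(1)]] by blast+
      have si: "square_integrable (s i)"
      proof (rule square_integrable_bounded[OF _ square_integrable_scale[OF f, of 2]])
        show "s i \<in> borel_measurable unit_interval"
          using s(1) by (rule borel_measurable_simple_function)
        show "AE t in unit_interval. \<bar>s i t\<bar> \<le> \<bar>2 * f t\<bar>"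
          using s(3) by (intro AE_I2) (auto simp: abs_mult)
      qed
      have "abs_L2 (s i) = abs_L2 ?g"
        by (rule abs_L2_eqI[OF si g(1) simple_function_indicator_representation_AE[OF s(1)[of i]]])
      then show ?thesis using g by simp
    qed
    then show ?thesis
    proof (rule closure_rat_comb_lim)
      show "(\<lambda>i. abs_L2 (s i)) \<longlonglongrightarrow> abs_L2 f"
      proof (rule L2_dominated_convergence[OF _ fm square_integrable_scale[OF f, of 2]])
        show "s i \<in> borel_measurable unit_interval" for i
          using s(1) by (rule borel_measurable_simple_function)
        show "AE t in unit_interval. \<bar>s i t\<bar> \<le> \<bar>2 * f t\<bar>" for i
          using s(3) by (intro AE_I2) (auto simp: abs_mult)
      qed (use s(2) in \<open>auto intro: AE_I2\<close>)
    qed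
  qed
  then have "x \<in> closure (range rat_comb)" for x
    using square_integrable_rep_L2[of x] abs_rep_L2[of x] by metis
  then show ?thesis by auto
qed

instance L2 :: second_countable_topology
proof
  let ?B = "(\<lambda>(l, n). ball (rat_comb l) (inverse (real (Suc n)))) ` UNIV"
  have "topological_basis ?B"
  proof (rule topological_basisI)
    fix U :: "L2 set" and x assume "open U" "x \<in> U"
    then obtain e where e: "0 < e" "ball x e \<subseteq> U" by (auto simp: open_contains_ball)
    obtain n where n: "inverse (real (Suc n)) < e / 2"
      using reals_Archimedean[of "e / 2"] e by auto
    have "x \<in> closure (range rat_comb)" by (simp add: closure_rat_comb)
    moreover have "0 < inverse (real (Suc n))" by simp
    ultimately have "\<exists>y\<in>range rat_comb. dist y x < inverse (real (Suc n))"
      by (simp only: closure_approachable)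
    then obtain l where l: "dist (rat_comb l) x < inverse (real (Suc n))"
      by (elim bexE rangeE) (simp only:)
    have "ball (rat_comb l) (inverse (real (Suc n))) \<subseteq> ball x e"
    proof
      fix y assume "y \<in> ball (rat_comb l) (inverse (real (Suc n)))"
      then show "y \<in> ball x e"
        using l n dist_triangle[of x y "rat_comb l"] by (simp add: dist_commute)
    qed
    then have "ball (rat_comb l) (inverse (real (Suc n))) \<subseteq> U"
      using e(2) by (rule subset_trans)
    moreover have "x \<in> ball (rat_comb l) (inverse (real (Suc n)))"
      using l by (simp only: mem_ball)
    moreover have "ball (rat_comb l) (inverse (real (Suc n))) \<in> ?B"
      by (rule image_eqI[of _ _ "(l, n)"]) simp_all
    ultimately show "\<exists>B'\<in>?B. x \<in> B' \<and> B' \<subseteq> U"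
      by (intro bexI conjI)
  qed auto
  then have "open = generate_topology ?B" by (rule topological_basis_imp_subbasis)
  moreover have "countable ?B" by simp
  ultimately show "\<exists>B::L2 set set. countable B \<and> open = generate_topology B"
    by (intro exI conjI)
qed

section \<open>Functional change-point model\<close>

definition iid :: "'w measure \<Rightarrow> 's measure \<Rightarrow> ('i \<Rightarrow> 'w \<Rightarrow> 's) \<Rightarrow> bool"
  where "iid M S Y \<longleftrightarrow> prob_space.indep_vars M (\<lambda>_. S) Y UNIV \<and>
    (\<forall>i j. distr M S (Y i) = distr M S (Y j))"

(* The family e' i l j consists of copies of e 0, independent of each other (over all i, l, j)
   and, as a family, independent of the whole sequence e. *)
definition independent_copies ::
    "'w measure \<Rightarrow> 's measure \<Rightarrow> (int \<Rightarrow> 'w \<Rightarrow> 's) \<Rightarrow> (int \<Rightarrow> nat \<Rightarrow> int \<Rightarrow> 'w \<Rightarrow> 's) \<Rightarrow> bool"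
  where "independent_copies M S e e' \<longleftrightarrow>
    prob_space.indep_vars M (\<lambda>_. S) (\<lambda>(i, l, j). e' i l j) UNIV \<and>
    (\<forall>i l j. distr M S (e' i l j) = distr M S (e 0)) \<and>
    prob_space.indep_set M
      {(\<lambda>\<omega> i. e i \<omega>) -` A \<inter> space M | A. A \<in> sets (Pi\<^sub>M UNIV (\<lambda>_. S))}
      {(\<lambda>\<omega> (i, l, j). e' i l j \<omega>) -` A \<inter> space M | A. A \<in> sets (Pi\<^sub>M UNIV (\<lambda>_. S))}"

(* Argument number k of g is the innovation with time index i - k: the first l arguments
   e i, ..., e (i - l + 1) are kept, all earlier ones are replaced by copies. *)
definition coupled_past ::
    "(int \<Rightarrow> 'w \<Rightarrow> 's) \<Rightarrow> (int \<Rightarrow> nat \<Rightarrow> int \<Rightarrow> 'w \<Rightarrow> 's) \<Rightarrow> int \<Rightarrow> nat \<Rightarrow> 'w \<Rightarrow> nat \<Rightarrow> 's"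
  where "coupled_past e e' i l \<omega> k =
    (if k < l then e (i - int k) \<omega> else e' i l (i - int k) \<omega>)"

(* Finiteness of the series of p-norms is spelled out as finiteness of every p-th moment
   together with summability of the p-norms. *)
definition weakly_dependent ::
    "'w measure \<Rightarrow> 's measure \<Rightarrow> ((nat \<Rightarrow> 's) \<Rightarrow> L2) \<Rightarrow> (int \<Rightarrow> 'w \<Rightarrow> 's) \<Rightarrow>
      (int \<Rightarrow> nat \<Rightarrow> int \<Rightarrow> 'w \<Rightarrow> 's) \<Rightarrow> (int \<Rightarrow> 'w \<Rightarrow> L2) \<Rightarrow> bool"
  where "weakly_dependent M S g e e' \<epsilon> \<longleftrightarrow>
    g \<in> borel_measurable (Pi\<^sub>M UNIV (\<lambda>_. S)) \<and>
    iid M S e \<and>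
    (\<forall>i. \<forall>\<omega>\<in>space M. \<epsilon> i \<omega> = g (\<lambda>k. e (i - int k) \<omega>)) \<and>
    independent_copies M S e e' \<and>
    (\<exists>p>2. \<forall>i.
      (\<forall>l. integrable M (\<lambda>\<omega>. norm (\<epsilon> i \<omega> - g (coupled_past e e' i l \<omega>)) powr p)) \<and>
      summable (\<lambda>l. (\<integral>\<omega>. norm (\<epsilon> i \<omega> - g (coupled_past e e' i l \<omega>)) powr p \<partial>M) powr (1 / p)))"

definition change_point :: "real \<Rightarrow> nat \<Rightarrow> int"
  where "change_point \<theta> n = \<lfloor>\<theta> * real n\<rfloor>"

definition observation ::
    "L2 \<Rightarrow> L2 \<Rightarrow> real \<Rightarrow> (int \<Rightarrow> 'w \<Rightarrow> L2) \<Rightarrow> nat \<Rightarrow> int \<Rightarrow> 'w \<Rightarrow> L2"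
  where "observation \<mu> \<delta> \<theta> \<epsilon> n i \<omega> =
    \<mu> + (if i > change_point \<theta> n then \<delta> else 0) + \<epsilon> i \<omega>"

definition cusum :: "(int \<Rightarrow> 'w \<Rightarrow> L2) \<Rightarrow> nat \<Rightarrow> nat \<Rightarrow> 'w \<Rightarrow> L2"
  where "cusum X n k \<omega> = (1 / sqrt (real n)) *\<^sub>R
    ((\<Sum>i\<in>{1..int k}. X i \<omega>) - (real k / real n) *\<^sub>R (\<Sum>i\<in>{1..int n}. X i \<omega>))"

definition test_statistic :: "(int \<Rightarrow> 'w \<Rightarrow> L2) \<Rightarrow> nat \<Rightarrow> 'w \<Rightarrow> real"
  where "test_statistic X n \<omega> = Max ((\<lambda>k. (norm (cusum X n k \<omega>))\<^sup>2) ` {1..n})"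

definition diverges_in_probability :: "'w measure \<Rightarrow> (nat \<Rightarrow> 'w \<Rightarrow> real) \<Rightarrow> bool"
  where "diverges_in_probability M T \<longleftrightarrow>
    (\<forall>K. (\<lambda>n. measure M {\<omega> \<in> space M. T n \<omega> > K}) \<longlonglongrightarrow> 1)"

end

theory Submission
  imports Defs
begin

text \<open>
  Since \<open>T\<^sub>n\<close> is a maximum, it suffices to look at \<open>k = k\<^sup>*\<close> and at the component of the CUSUM process
  in the direction \<open>\<delta>\<close>. There the signal is of exact order \<open>\<surd>n\<close>, namely
  \<open>\<surd>n (k/n) (1 - k/n) \<parallel>\<delta>\<parallel>\<^sup>2\<close>, and the noise is stochastically bounded: the scalars
  \<open>Y\<^sub>i = \<langle>\<epsilon>\<^sub>i, \<delta>\<rangle>\<close> have summable covariances, so that the second moment of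
  \<open>Y\<^sub>1 + \<dots> + Y\<^sub>m\<close> is \<open>O(m)\<close>, and Chebyshev's inequality applies. The covariances are summable because
  \<open>Y\<^sub>j\<^sub>-\<^sub>l\<close> is uncorrelated with the coupled version of \<open>Y\<^sub>j\<close> that keeps only the last \<open>l\<close> innovations,
  whence \<open>|E Y\<^sub>j\<^sub>-\<^sub>l Y\<^sub>j|\<close> is at most a constant times the \<open>p\<close>-norm of the coupling error at lag \<open>l\<close>.
  Square integrability of \<open>Y\<close> comes from the coupling at lag \<open>0\<close>, where the whole past is replaced.
\<close>

section \<open>Joint law of the innovations and their copies\<close>

text \<open>The joint law of an independent family is the product of its marginals, and reading
  coordinates along an injection carries a product measure to a product measure. This covers both
  the reversed past \<open>j - int k\<close> and a single sequence cut out of the triply indexed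
  copies.\<close>

lemma (in prob_space) distr_reindexed_iid:
  assumes indep: "indep_vars (\<lambda>_. S) Y UNIV" and inj: "inj f"
    and law: "\<And>i. distr M S (Y i) = N"
  shows "distr M (Pi\<^sub>M UNIV (\<lambda>_. S)) (\<lambda>\<omega> k. Y (f k) \<omega>) = Pi\<^sub>M UNIV (\<lambda>_. N)"
proof -
  have Y [measurable]: "Y i \<in> measurable M S" for i
    using indep by (simp add: indep_vars_def)
  have N: "prob_space N" and sets_N: "sets N = sets S"
    unfolding law[of undefined, symmetric] by (auto intro: prob_space_distr)
  have "distr M (Pi\<^sub>M UNIV (\<lambda>_. S)) (\<lambda>\<omega> k. Y (f k) \<omega>)
      = distr (distr M (Pi\<^sub>M UNIV (\<lambda>_. S)) (\<lambda>\<omega> i. Y i \<omega>)) (Pi\<^sub>M UNIV (\<lambda>_. S)) (\<lambda>x k. x (f k))"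
    by (subst distr_distr)
      (auto simp: comp_def space_PiM PiE_iff intro!: measurable_PiM_single' measurable_space[OF Y])
  also have "distr M (Pi\<^sub>M UNIV (\<lambda>_. S)) (\<lambda>\<omega> i. Y i \<omega>) = Pi\<^sub>M UNIV (\<lambda>_. N)"
    using indep indep_vars_iff_distr_eq_PiM'[where I = UNIV and M' = "\<lambda>_. S" and X = Y] by (simp add: law restrict_UNIV)
  also have "distr (Pi\<^sub>M UNIV (\<lambda>_. N)) (Pi\<^sub>M UNIV (\<lambda>_. S)) (\<lambda>x k. x (f k)) = Pi\<^sub>M UNIV (\<lambda>_. N)"
  proof -
    have "distr (Pi\<^sub>M UNIV (\<lambda>_. N)) (Pi\<^sub>M UNIV (\<lambda>_. S)) (\<lambda>x k. x (f k))
        = distr (Pi\<^sub>M UNIV (\<lambda>_. N)) (Pi\<^sub>M UNIV (\<lambda>_. N)) (\<lambda>x k. x (f k))"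
      by (intro distr_cong sets_PiM_cong) (simp_all add: sets_N)
    then show ?thesis
      using distr_PiM_reindex[of UNIV "\<lambda>_. N" f UNIV] N inj by (simp add: restrict_UNIV)
  qed
  finally show ?thesis .
qed

text \<open>Each component has law \<open>P\<close> by reindexing. The two are independent because
  each is a function of one of the whole families that \<open>independent_copies\<close> declares
  independent, and values on rectangles determine the product measure. The second component also
  lists the copies at positions below \<open>l\<close>, so that both components are sequences of the
  same kind; splicing discards these entries later.\<close>

lemma distr_past_and_copies:
  assumes "prob_space M" and iid: "iid M S e" and copies: "independent_copies M S e e'"
  defines "N \<equiv> Pi\<^sub>M UNIV (\<lambda>_::nat. S)" and "P \<equiv> Pi\<^sub>M UNIV (\<lambda>_::nat. distr M S (e 0))"
  shows "distr M (N \<Otimes>\<^sub>M N) (\<lambda>\<omega>. (\<lambda>k. e (j - int k) \<omega>, \<lambda>k. e' j l (j - int k) \<omega>)) = P \<Otimes>\<^sub>M P"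
proof -
  interpret prob_space M by fact
  let ?U = "\<lambda>\<omega> k. e (j - int k) \<omega>" and ?V = "\<lambda>\<omega> k. e' j l (j - int k) \<omega>"
  let ?e = "\<lambda>\<omega> i. e i \<omega>" and ?e' = "\<lambda>\<omega> (i, l, j). e' i l j \<omega>"
  let ?r = "\<lambda>x k. x (j - int k)" and ?r' = "\<lambda>x k. x (j, l, j - int k)"
  have e [measurable]: "e i \<in> measurable M S" for i
    using iid by (simp add: iid_def indep_vars_def)
  have "(\<lambda>(i, l, j). e' i l j) (i, l, j) \<in> measurable M S" for i l j
    using copies unfolding independent_copies_def indep_vars_def by blast
  then have e' [measurable]: "e' i l j \<in> measurable M S" for i l j by simp
  have U [measurable]: "?U \<in> measurable M N" unfolding N_def
    by (rule measurable_PiM_single') (auto intro: measurable_space[OF e])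
  have V [measurable]: "?V \<in> measurable M N" unfolding N_def
    by (rule measurable_PiM_single') (auto intro: measurable_space[OF e'])
  have U_law: "distr M N ?U = P"
    unfolding N_def P_def using iid
    by (intro distr_reindexed_iid) (auto simp: iid_def inj_def)
  have V_law: "distr M N ?V = P"
    using distr_reindexed_iid[of S "\<lambda>(i, l, j). e' i l j" "\<lambda>k. (j, l, j - int k)" "distr M S (e 0)"] copies
    by (auto simp: independent_copies_def inj_def N_def P_def)
  interpret P: prob_space P
    unfolding U_law[symmetric] by (rule prob_space_distr) measurable
  have sets_P: "sets P = sets N"
    unfolding N_def P_def by (intro sets_PiM_cong) auto
  have prod: "emeasure P A * emeasure P B = emeasure (distr M (N \<Otimes>\<^sub>M N) (\<lambda>\<omega>. (?U \<omega>, ?V \<omega>))) (A \<times> B)"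
    if "A \<in> sets P" "B \<in> sets P" for A B
  proof -
    have [measurable]: "A \<in> sets N" "B \<in> sets N" using that sets_P by auto
    have "?r \<in> measurable (Pi\<^sub>M UNIV (\<lambda>_. S)) N" unfolding N_def
      by (rule measurable_PiM_single') (auto simp: space_PiM)
    then have rA: "?r -` A \<inter> space (Pi\<^sub>M UNIV (\<lambda>_. S)) \<in> sets (Pi\<^sub>M UNIV (\<lambda>_. S))" by measurable
    have "?r' \<in> measurable (Pi\<^sub>M UNIV (\<lambda>_. S)) N" unfolding N_def
      by (rule measurable_PiM_single') (auto simp: space_PiM)
    then have rB: "?r' -` B \<inter> space (Pi\<^sub>M UNIV (\<lambda>_. S)) \<in> sets (Pi\<^sub>M UNIV (\<lambda>_. S))" by measurable
    \<comment> \<open>Independence is given for preimages under the full families, so both events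
      are pulled back through the index maps \<open>?r\<close> and \<open>?r'\<close>.\<close>
    have UA: "?U -` A \<inter> space M = ?e -` (?r -` A \<inter> space (Pi\<^sub>M UNIV (\<lambda>_. S))) \<inter> space M"
      using measurable_space[OF e] by (auto simp: space_PiM)
    have VB: "?V -` B \<inter> space M = ?e' -` (?r' -` B \<inter> space (Pi\<^sub>M UNIV (\<lambda>_. S))) \<inter> space M"
      using measurable_space[OF e'] by (auto simp: space_PiM)
    have "prob ((?U -` A \<inter> space M) \<inter> (?V -` B \<inter> space M))
        = prob (?U -` A \<inter> space M) * prob (?V -` B \<inter> space M)"
      by (rule indep_setD[OF copies[unfolded independent_copies_def, THEN conjunct2, THEN conjunct2]])
        (use rA rB UA VB in blast)+
    moreover have "(\<lambda>\<omega>. (?U \<omega>, ?V \<omega>)) -` (A \<times> B) \<inter> space M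
        = (?U -` A \<inter> space M) \<inter> (?V -` B \<inter> space M)" by auto
    ultimately have "emeasure (distr M (N \<Otimes>\<^sub>M N) (\<lambda>\<omega>. (?U \<omega>, ?V \<omega>))) (A \<times> B)
        = emeasure (distr M N ?U) A * emeasure (distr M N ?V) B"
      by (simp add: emeasure_distr emeasure_eq_measure ennreal_mult)
    then show ?thesis by (simp add: U_law V_law)
  qed
  have "sets (P \<Otimes>\<^sub>M P) = sets (N \<Otimes>\<^sub>M N)"
    by (intro sets_pair_measure_cong sets_P)
  then show ?thesis
    by (intro pair_measure_eqI[symmetric] P.sigma_finite_measure_axioms prod) auto
qed

section \<open>Decorrelation and square integrability on the sequence space\<close>

text \<open>Fix \<open>v\<close>. The coordinates of \<open>u\<close> from \<open>l\<close> on are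
  independent of the first \<open>l\<close> and again have law \<open>S\<close>. The first factor
  depends on the former alone, the second on the latter alone, so integrating the former out
  produces the mean of \<open>h\<close>, which is zero.\<close>

lemma (in sequence_space) integral_shift_mult_splice_eq_0:
  fixes h :: "(nat \<Rightarrow> 'a) \<Rightarrow> real"
  assumes [measurable]: "h \<in> borel_measurable S" and h0: "(\<integral>x. h x \<partial>S) = 0"
  shows "(\<integral>(u, v). h (\<lambda>k. u (k + l)) * h (comb_seq l u (\<lambda>k. v (k + l))) \<partial>(S \<Otimes>\<^sub>M S)) = 0"
    (is "integral\<^sup>L _ ?F = 0")
proof (cases "integrable (S \<Otimes>\<^sub>M S) ?F")
  \<comment> \<open>The integral of a non-integrable function is \<open>0\<close> by convention.\<close>
  case True
  interpret PP: pair_sigma_finite S S ..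
  have [measurable]: "(\<lambda>u k. u (k + l)) \<in> measurable S S"
    by (rule measurable_PiM_single') (auto simp: space_PiM)
  have inner0: "(\<integral>u. h (\<lambda>k. u (k + l)) * h (comb_seq l u w) \<partial>S) = 0" if "w \<in> space S" for w
  proof -
    have [measurable]: "(\<lambda>_. w) \<in> measurable X S" for X using that by simp
    let ?G = "\<lambda>(a, b). h b * h (comb_seq l a w)"
    \<comment> \<open>An iid sequence has the law of the splice of two independent ones; this splits
      \<open>u\<close> at position \<open>l\<close>.\<close>
    have "(\<integral>u. h (\<lambda>k. u (k + l)) * h (comb_seq l u w) \<partial>S)
        = (\<integral>u. h (\<lambda>k. u (k + l)) * h (comb_seq l u w) \<partial>distr (S \<Otimes>\<^sub>M S) S (\<lambda>(a, b). comb_seq l a b))"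
      by (simp only: PiM_comb_seq)
    also have "\<dots> = (\<integral>(a, b). h (\<lambda>k. comb_seq l a b (k + l)) * h (comb_seq l (comb_seq l a b) w) \<partial>(S \<Otimes>\<^sub>M S))"
      by (subst integral_distr) (auto simp: case_prod_beta')
    \<comment> \<open>Shifting the splice by \<open>l\<close> returns \<open>b\<close>, and splicing
      with \<open>w\<close> at the same position discards \<open>b\<close>, so only the first factor
      still contains it.\<close>
    also have "\<dots> = integral\<^sup>L (S \<Otimes>\<^sub>M S) ?G"
      by (intro Bochner_Integration.integral_cong)
        (auto simp: comb_seq_add comb_seq_def fun_eq_iff intro!: arg_cong[where f=h])
    also have "\<dots> = 0"
    proof (cases "integrable (S \<Otimes>\<^sub>M S) ?G")
      case True
      then have "integral\<^sup>L (S \<Otimes>\<^sub>M S) ?G = (\<integral>a. \<integral>b. h b * h (comb_seq l a w) \<partial>S \<partial>S)"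
        by (subst PP.integral_fst'[OF True, symmetric]) simp
      then show ?thesis by (simp add: h0)
    qed (rule not_integrable_integral_eq)
    finally show ?thesis .
  qed
  have "integral\<^sup>L (S \<Otimes>\<^sub>M S) ?F = (\<integral>v. \<integral>u. h (\<lambda>k. u (k + l)) * h (comb_seq l u (\<lambda>k. v (k + l))) \<partial>S \<partial>S)"
    using True by (subst PP.integral_snd) auto
  also have "\<dots> = (\<integral>v. 0 \<partial>S)"
  proof (rule Bochner_Integration.integral_cong)
    fix v assume "v \<in> space S"
    then show "(\<integral>u. h (\<lambda>k. u (k + l)) * h (comb_seq l u (\<lambda>k. v (k + l))) \<partial>S) = 0"
      by (intro inner0) (auto simp: space_PiM)
  qed simp
  finally show ?thesis by simp
qed (rule not_integrable_integral_eq)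

text \<open>By Fubini almost every section of the difference is square integrable, hence at least
  one is. In that section \<open>h v\<close> is a constant, and adding a constant does not affect
  square integrability on a probability space.\<close>

lemma (in prob_space) square_integrable_of_symmetrization:
  fixes h :: "'a \<Rightarrow> real"
  assumes [measurable]: "h \<in> borel_measurable M"
    and int: "integrable (M \<Otimes>\<^sub>M M) (\<lambda>(u, v). (h u - h v)\<^sup>2)"
  shows "integrable M (\<lambda>u. (h u)\<^sup>2)"
proof -
  interpret PP: pair_sigma_finite M M ..
  have "AE v in M. integrable M (\<lambda>u. (h v - h u)\<^sup>2)"
    using PP.AE_integrable_fst'[OF int] by simp
  then have "\<exists>v. integrable M (\<lambda>u. (h v - h u)\<^sup>2)"
    by (rule eventually_happens'[OF ae_filter_bot])
  then obtain v where v: "integrable M (\<lambda>u. (h v - h u)\<^sup>2)" ..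
  show ?thesis
  proof (rule Bochner_Integration.integrable_bound)
    show "integrable M (\<lambda>u. 2 * (h v - h u)\<^sup>2 + 2 * (h v)\<^sup>2)" using v by simp
    show "AE u in M. norm ((h u)\<^sup>2) \<le> norm (2 * (h v - h u)\<^sup>2 + 2 * (h v)\<^sup>2)"
    proof (rule AE_I2)
      fix u
      \<comment> \<open>This square is exactly the right side of the bound minus the left
        side.\<close>
      have "0 \<le> (2 * h v - h u)\<^sup>2" by simp
      then show "norm ((h u)\<^sup>2) \<le> norm (2 * (h v - h u)\<^sup>2 + 2 * (h v)\<^sup>2)"
        by (simp add: power2_eq_square algebra_simps)
    qed
  qed simp
qed

section \<open>Moment inequalities\<close>

lemma power2_le_one_plus_powr:
  fixes t p :: real
  assumes "0 \<le> t" "2 \<le> p"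
  shows "t\<^sup>2 \<le> 1 + t powr p"
proof (cases "t \<le> 1")
  case True
  then have "t\<^sup>2 \<le> 1" using assms by (simp add: power_le_one)
  then show ?thesis by (simp add: add_increasing2)
next
  case False
  then have "t powr 2 \<le> t powr p" using assms by (intro powr_mono) auto
  then show ?thesis using False by simp
qed

text \<open>Hoelder's inequality up to a constant, from Young's inequality: if \<open>a\<^sup>p\<close> is the expectation of
  \<open>W\<^sup>p\<close> and \<open>t = W / a\<close>, then \<open>|X| W = a |X| t \<le> a (X\<^sup>2 + t\<^sup>2)\<close> and \<open>t\<^sup>2 \<le> 1 + t\<^sup>p\<close>.\<close>

lemma (in prob_space) expectation_abs_mult_le_Lp:
  fixes X W :: "'a \<Rightarrow> real"
  assumes [measurable]: "X \<in> borel_measurable M" "W \<in> borel_measurable M"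
    and X: "integrable M (\<lambda>x. (X x)\<^sup>2)"
    and W: "integrable M (\<lambda>x. W x powr p)" "\<And>x. 0 \<le> W x" and p: "2 < p"
  shows "integrable M (\<lambda>x. \<bar>X x\<bar> * W x)"
    and "(\<integral>x. \<bar>X x\<bar> * W x \<partial>M) \<le> (\<integral>x. W x powr p \<partial>M) powr (1/p) * ((\<integral>x. (X x)\<^sup>2 \<partial>M) + 2)"
proof -
  let ?m = "\<integral>x. W x powr p \<partial>M"
  have m: "0 \<le> ?m" by simp
  have young: "\<bar>X x\<bar> * W x \<le> a * ((X x)\<^sup>2 + 1 + (W x powr p) / (a powr p))" if a: "0 < a" for a x
  proof -
    define t where "t = W x / a"
    have t: "0 \<le> t" "W x = a * t" using a W(2)[of x] by (auto simp: t_def)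
    have "0 \<le> (\<bar>X x\<bar> - t)\<^sup>2" "0 \<le> \<bar>X x\<bar> * t" using t by simp_all
    then have "\<bar>X x\<bar> * t \<le> (X x)\<^sup>2 + t\<^sup>2"
      unfolding power2_diff power2_abs by linarith
    also have "\<dots> \<le> (X x)\<^sup>2 + 1 + t powr p"
      using power2_le_one_plus_powr[of t p] t p by simp
    finally have "a * (\<bar>X x\<bar> * t) \<le> a * ((X x)\<^sup>2 + 1 + t powr p)" using a by simp
    moreover have "t powr p = (W x powr p) / (a powr p)"
      unfolding t_def using a W(2)[of x] by (simp add: powr_divide)
    ultimately show ?thesis by (simp add: t(2) mult.left_commute)
  qed
  have int: "integrable M (\<lambda>x. a * ((X x)\<^sup>2 + 1 + (W x powr p) / (a powr p)))" for a
    using X W by simp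
  show *: "integrable M (\<lambda>x. \<bar>X x\<bar> * W x)"
    by (rule Bochner_Integration.integrable_bound[OF int[of 1]])
      (use young[of 1] W(2) in \<open>auto intro!: AE_I2 simp: abs_mult intro: order_trans[OF _ abs_ge_self]\<close>)
  show "(\<integral>x. \<bar>X x\<bar> * W x \<partial>M) \<le> ?m powr (1/p) * ((\<integral>x. (X x)\<^sup>2 \<partial>M) + 2)"
  \<comment> \<open>Dividing by \<open>a\<close> is impossible if the p-th moment vanishes; then
    \<open>W\<close> is zero almost everywhere and both sides are zero.\<close>
  proof (cases "?m = 0")
    case True
    then have "AE x in M. W x powr p = 0"
      using integral_nonneg_eq_0_iff_AE[OF W(1)] by simp
    then have "AE x in M. \<bar>X x\<bar> * W x = 0" by eventually_elim simp
    then have "(\<integral>x. \<bar>X x\<bar> * W x \<partial>M) = 0"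
      by (rule integral_eq_zero_AE)
    then show ?thesis using True by simp
  next
    case False
    define a where "a = ?m powr (1/p)"
    have a: "0 < a" "a powr p = ?m" using False m p by (auto simp: a_def powr_powr)
    have "(\<integral>x. \<bar>X x\<bar> * W x \<partial>M) \<le> (\<integral>x. a * ((X x)\<^sup>2 + 1 + (W x powr p) / (a powr p)) \<partial>M)"
      by (intro integral_mono * int young a)
    also have "\<dots> = a * ((\<integral>x. (X x)\<^sup>2 \<partial>M) + 1 + ?m / a powr p)"
      using X W by (simp add: prob_space)
    \<comment> \<open>By the choice of \<open>a\<close> the normalised p-th moment is 1; together
      with the 1 from the bound on the square it gives the constant 2.\<close>
    also have "\<dots> = a * ((\<integral>x. (X x)\<^sup>2 \<partial>M) + 2)" using False by (simp add: a)
    finally show ?thesis by (simp add: a_def)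
  qed
qed

lemma (in prob_space) integrable_mult_of_squares:
  fixes X Y :: "'a \<Rightarrow> real"
  assumes [measurable]: "X \<in> borel_measurable M" "Y \<in> borel_measurable M"
    and X: "integrable M (\<lambda>x. (X x)\<^sup>2)" and Y: "integrable M (\<lambda>x. (Y x)\<^sup>2)"
  shows "integrable M (\<lambda>x. X x * Y x)"
proof (rule Bochner_Integration.integrable_bound)
  show "integrable M (\<lambda>x. (X x)\<^sup>2 + (Y x)\<^sup>2)" using X Y by simp
  show "AE x in M. norm (X x * Y x) \<le> norm ((X x)\<^sup>2 + (Y x)\<^sup>2)"
  proof (rule AE_I2)
    fix x
    have "0 \<le> (\<bar>X x\<bar> - \<bar>Y x\<bar>)\<^sup>2" "0 \<le> \<bar>X x\<bar> * \<bar>Y x\<bar>" by simp_all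
    then show "norm (X x * Y x) \<le> norm ((X x)\<^sup>2 + (Y x)\<^sup>2)"
      unfolding power2_diff power2_abs real_norm_def abs_mult by linarith
  qed
qed simp

text \<open>Induction on \<open>k\<close>: a new summand adds its own second moment, at most
  \<open>r 0\<close>, and twice its covariances with the earlier ones, at most
  \<open>r 1 + ... + r k\<close> before doubling. Each step thus costs at most twice the sum of
  \<open>r\<close>. Integrability is carried along because the integral of the expanded square has
  to be split.\<close>

lemma (in prob_space) second_moment_sum_le:
  fixes Y :: "int \<Rightarrow> 'a \<Rightarrow> real"
  assumes [measurable]: "\<And>i. Y i \<in> borel_measurable M"
    and sq: "\<And>i. integrable M (\<lambda>x. (Y i x)\<^sup>2)"
    and cov: "\<And>j l. \<bar>\<integral>x. Y (j - int l) x * Y j x \<partial>M\<bar> \<le> r l"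
    and r: "summable r"
  shows "(\<integral>x. (\<Sum>i\<in>{1..int k}. Y i x)\<^sup>2 \<partial>M) \<le> real k * (2 * suminf r)
    \<and> integrable M (\<lambda>x. (\<Sum>i\<in>{1..int k}. Y i x)\<^sup>2)"
proof (induction k)
  case (Suc k)
  let ?S = "\<lambda>x. \<Sum>i\<in>{1..int k}. Y i x" and ?j = "int (Suc k)"
  have YY: "integrable M (\<lambda>x. Y i x * Y j x)" for i j
    by (intro integrable_mult_of_squares sq) measurable
  have r0: "0 \<le> r l" for l using cov[of 0 l] by (meson abs_ge_zero order_trans)
  have "{1..?j} = insert ?j {1..int k}" by auto
  then have sum: "(\<Sum>i\<in>{1..?j}. Y i x) = ?S x + Y ?j x" for x by simp
  have expand: "(\<Sum>i\<in>{1..?j}. Y i x)\<^sup>2 = (?S x)\<^sup>2 + (Y ?j x)\<^sup>2 + 2 * (\<Sum>i\<in>{1..int k}. Y i x * Y ?j x)" for x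
    unfolding sum power2_sum by (simp add: sum_distrib_right)
  have "(\<Sum>i\<in>{1..int k}. \<integral>x. Y i x * Y ?j x \<partial>M) \<le> (\<Sum>i\<in>{1..int k}. r (nat (?j - i)))"
  proof (rule sum_mono)
    fix i assume "i \<in> {1..int k}"
    then have "?j - int (nat (?j - i)) = i" by simp
    then show "(\<integral>x. Y i x * Y ?j x \<partial>M) \<le> r (nat (?j - i))"
      using cov[of ?j "nat (?j - i)"] by simp
  qed
  \<comment> \<open>Sum over the lag \<open>l = ?j - i\<close> instead of the time
    \<open>i\<close>.\<close>
  also have "\<dots> = sum r {1..k}"
    by (rule sum.reindex_bij_witness[of _ "\<lambda>l. ?j - int l" "\<lambda>i. nat (?j - i)"]) auto
  finally have cross: "(\<Sum>i\<in>{1..int k}. \<integral>x. Y i x * Y ?j x \<partial>M) \<le> sum r {1..k}" .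
  have "(\<integral>x. (Y ?j x)\<^sup>2 \<partial>M) \<le> r 0"
    using cov[of ?j 0] by (simp add: power2_eq_square)
  moreover have "r 0 + sum r {1..k} = sum r {..k}"
    by (simp add: atLeast0AtMost[symmetric] sum.atLeast_Suc_atMost[of 0])
  moreover have "sum r {..k} \<le> suminf r" by (intro sum_le_suminf r r0) auto
  moreover have "(\<integral>x. (\<Sum>i\<in>{1..?j}. Y i x)\<^sup>2 \<partial>M)
      = (\<integral>x. (?S x)\<^sup>2 \<partial>M) + (\<integral>x. (Y ?j x)\<^sup>2 \<partial>M) + 2 * (\<Sum>i\<in>{1..int k}. \<integral>x. Y i x * Y ?j x \<partial>M)"
    unfolding expand using Suc sq YY by simp
  \<comment> \<open>The diagonal term occurs once and the cross terms twice; nonnegativity allows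
    doubling all of them.\<close>
  moreover have "0 \<le> r 0" by (rule r0)
  ultimately have "(\<integral>x. (\<Sum>i\<in>{1..?j}. Y i x)\<^sup>2 \<partial>M) \<le> real (Suc k) * (2 * suminf r)"
    using Suc cross by (simp add: algebra_simps)
  moreover have "integrable M (\<lambda>x. (\<Sum>i\<in>{1..?j}. Y i x)\<^sup>2)"
    unfolding expand using Suc sq YY by simp
  ultimately show ?case by blast
qed simp


section \<open>Linear growth of the second moment of the projected partial sums\<close>

text \<open>The pair \<open>(U j, V j l)\<close> has the same product law for all \<open>j\<close>
  and \<open>l\<close>, and the projected error, its coupled version and the coupling error are
  fixed functions of such a pair. All bounds therefore depend on the lag only and can be computed on
  the product space.\<close>

lemma weakly_dependent_second_moment_sum_le:
  fixes \<delta> :: L2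
  assumes "prob_space M"
    and [measurable]: "\<And>i. \<epsilon> i \<in> borel_measurable M"
    and int: "\<And>i. integrable M (\<epsilon> i)" and mean: "\<And>i. (\<integral>\<omega>. \<epsilon> i \<omega> \<partial>M) = 0"
    and dep: "weakly_dependent M S g e e' \<epsilon>"
  obtains C where "\<And>k. integrable M (\<lambda>\<omega>. (\<Sum>i\<in>{1..int k}. inner (\<epsilon> i \<omega>) \<delta>)\<^sup>2)"
    and "\<And>k. (\<integral>\<omega>. (\<Sum>i\<in>{1..int k}. inner (\<epsilon> i \<omega>) \<delta>)\<^sup>2 \<partial>M) \<le> C * real k"
proof -
  interpret prob_space M by fact
  define N where "N = Pi\<^sub>M UNIV (\<lambda>_::nat. S)"
  define Y where "Y i \<omega> = inner (\<epsilon> i \<omega>) \<delta>" for i \<omega>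
  define h where "h x = inner (g x) \<delta>" for x
  define R where "R j l \<omega> = norm (\<epsilon> j \<omega> - g (coupled_past e e' j l \<omega>))" for j l \<omega>
  define U where "U j \<omega> = (\<lambda>k. e (j - int k) \<omega>)" for j \<omega>
  define V where "V j l \<omega> = (\<lambda>k. e' j l (j - int k) \<omega>)" for j l \<omega>
  \<comment> \<open>The coupling error as a function of two sequences. \<open>comb_seq\<close>
    restarts its second argument at index 0, whereas the copies sit at their absolute positions; the
    shift by \<open>l\<close> makes up for this.\<close>
  define W where "W l = (\<lambda>(u, v). norm (g u - g (comb_seq l u (\<lambda>k. v (k + l)))))" for l
  from dep have iid: "iid M S e" and copies: "independent_copies M S e e'"
    and g [measurable]: "g \<in> borel_measurable N"
    and eps: "\<And>i \<omega>. \<omega> \<in> space M \<Longrightarrow> \<epsilon> i \<omega> = g (U i \<omega>)"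
    by (auto simp: weakly_dependent_def N_def U_def)
  from dep obtain p where p: "2 < p"
    and Rint: "\<And>j l. integrable M (\<lambda>\<omega>. R j l \<omega> powr p)"
    and Rsum: "\<And>j. summable (\<lambda>l. (\<integral>\<omega>. R j l \<omega> powr p \<partial>M) powr (1 / p))"
    by (auto simp: weakly_dependent_def R_def)
  have [measurable]: "e i \<in> measurable M S" for i
    using iid by (simp add: iid_def indep_vars_def)
  interpret D: prob_space "distr M S (e 0)" by (rule prob_space_distr) measurable
  interpret P: sequence_space "distr M S (e 0)" ..
  let ?P = "P.S"
  interpret PP: pair_prob_space ?P ?P ..
  \<comment> \<open>Integrals are taken over \<open>?P\<close> and measurability is proved over
    \<open>N\<close>; both have the same sigma-algebra.\<close>
  have sets_P: "sets ?P = sets N"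
    unfolding N_def by (intro sets_PiM_cong) auto
  have [measurable_cong]: "sets ?P = sets N" by (rule sets_P)
  have law: "distr M (N \<Otimes>\<^sub>M N) (\<lambda>\<omega>. (U j \<omega>, V j l \<omega>)) = ?P \<Otimes>\<^sub>M ?P" for j l
    using distr_past_and_copies[OF \<open>prob_space M\<close> iid copies, of j l]
    by (simp add: N_def U_def V_def)
  have lawU: "distr M N (U j) = ?P" for j
    unfolding N_def U_def using iid
    by (intro distr_reindexed_iid) (auto simp: iid_def inj_def)
  have "(\<lambda>(i, l, j). e' i l j) (i, l, j) \<in> measurable M S" for i l j
    using copies unfolding independent_copies_def indep_vars_def by blast
  then have e' [measurable]: "e' i l j \<in> measurable M S" for i l j by simp
  have e_space: "e i \<omega> \<in> space S" "e' i l j \<omega> \<in> space S" if "\<omega> \<in> space M" for i l j \<omega>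
    using that by (auto intro: measurable_space[of _ M S])
  have [measurable]: "U j \<in> measurable M N" "V j l \<in> measurable M N" for j l
    unfolding N_def U_def V_def by (rule measurable_PiM_single'; auto intro: e_space)+
  have shift [measurable]: "(\<lambda>u k. u (k + l)) \<in> measurable N N" for l
    unfolding N_def by (rule measurable_PiM_single') (auto simp: space_PiM)
  have splice [measurable]: "(\<lambda>(u, v). comb_seq l u (\<lambda>k. v (k + l))) \<in> measurable (N \<Otimes>\<^sub>M N) N" for l
    unfolding case_prod_beta'
    by (rule measurable_comb_seq'[where M = S, folded N_def]) measurable
  have [measurable]: "h \<in> borel_measurable N" "W l \<in> borel_measurable (N \<Otimes>\<^sub>M N)" for l
    unfolding h_def W_def by measurable
  have coupled: "coupled_past e e' j l \<omega> = comb_seq l (U j \<omega>) (\<lambda>k. V j l \<omega> (k + l))" for j l \<omega>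
    by (auto simp: coupled_past_def comb_seq_def U_def V_def fun_eq_iff)
  have R_W: "R j l \<omega> = W l (U j \<omega>, V j l \<omega>)" if "\<omega> \<in> space M" for j l \<omega>
    by (simp add: R_def W_def coupled eps[OF that])
  have [measurable]: "R j l \<in> borel_measurable M" for j l
    by (subst measurable_cong[OF R_W]) measurable
  have Y_h: "Y j \<omega> = h (U j \<omega>)" if "\<omega> \<in> space M" for j \<omega>
    by (simp add: Y_def h_def eps[OF that])
  have [measurable]: "Y j \<in> borel_measurable M" for j
    unfolding Y_def by measurable

  \<comment> \<open>The p-norm of the coupling error at lag \<open>l\<close>, the same for every
    time \<open>j\<close>.\<close>
  define a where "a l = (\<integral>x. W l x powr p \<partial>(?P \<Otimes>\<^sub>M ?P)) powr (1 / p)" for l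
  have W_int: "integrable (?P \<Otimes>\<^sub>M ?P) (\<lambda>x. W l x powr p)" for l
  proof -
    have "integrable M (\<lambda>\<omega>. W l (U 0 \<omega>, V 0 l \<omega>) powr p)"
      using Rint[of 0 l] by (subst Bochner_Integration.integrable_cong[OF refl, of _ _ "\<lambda>\<omega>. R 0 l \<omega> powr p"]) (simp_all add: R_W)
    then show ?thesis
      by (subst law[symmetric, of 0 l], subst integrable_distr_eq) auto
  qed
  have R_a: "(\<integral>\<omega>. R j l \<omega> powr p \<partial>M) powr (1 / p) = a l" for j l
  proof -
    have "(\<integral>\<omega>. R j l \<omega> powr p \<partial>M) = (\<integral>\<omega>. W l (U j \<omega>, V j l \<omega>) powr p \<partial>M)"
      by (intro Bochner_Integration.integral_cong) (simp_all add: R_W)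
    also have "\<dots> = (\<integral>x. W l x powr p \<partial>(?P \<Otimes>\<^sub>M ?P))"
      by (subst law[symmetric, of j l], subst integral_distr) auto
    finally show ?thesis by (simp add: a_def)
  qed
  have a_sum: "summable a" using Rsum[of 0] by (simp add: R_a)
  \<comment> \<open>At lag 0 the splice is \<open>v\<close> itself, so \<open>W 0\<close> controls
    \<open>h u - h v\<close> for independent \<open>u\<close> and \<open>v\<close>, which is the
    symmetrised function.\<close>
  have h_sq: "integrable ?P (\<lambda>x. (h x)\<^sup>2)"
  proof (rule P.square_integrable_of_symmetrization)
    show "integrable (?P \<Otimes>\<^sub>M ?P) (\<lambda>(u, v). (h u - h v)\<^sup>2)"
    proof (rule Bochner_Integration.integrable_bound)
      show "integrable (?P \<Otimes>\<^sub>M ?P) (\<lambda>x. (norm \<delta>)\<^sup>2 * (1 + W 0 x powr p))"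
        using W_int by (intro integrable_mult_right Bochner_Integration.integrable_add PP.P.integrable_const)
      show "AE x in ?P \<Otimes>\<^sub>M ?P. norm (case x of (u, v) \<Rightarrow> (h u - h v)\<^sup>2)
          \<le> norm ((norm \<delta>)\<^sup>2 * (1 + W 0 x powr p))"
      proof (rule AE_I2, clarsimp simp: abs_mult)
        fix u v
        have "\<bar>h u - h v\<bar> \<le> norm (g u - g v) * norm \<delta>"
          unfolding h_def inner_diff_left[symmetric] by (rule Cauchy_Schwarz_ineq2)
        then have "(h u - h v)\<^sup>2 \<le> (norm (g u - g v))\<^sup>2 * (norm \<delta>)\<^sup>2"
          by (metis abs_ge_zero power2_abs power_mono power_mult_distrib)
        also have "\<dots> \<le> (1 + W 0 (u, v) powr p) * (norm \<delta>)\<^sup>2"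
          using power2_le_one_plus_powr[of "norm (g u - g v)" p] p
          by (intro mult_right_mono) (simp_all add: W_def comb_seq_0)
        finally show "(h u - h v)\<^sup>2 \<le> (norm \<delta>)\<^sup>2 * (1 + W 0 (u, v) powr p)"
          by (simp add: mult.commute)
      qed
    qed measurable
  qed measurable
  define A where "A = (\<integral>x. (h x)\<^sup>2 \<partial>?P)"
  have Y_sq: "integrable M (\<lambda>\<omega>. (Y j \<omega>)\<^sup>2)" and Y_A: "(\<integral>\<omega>. (Y j \<omega>)\<^sup>2 \<partial>M) = A" for j
  proof -
    have "integrable M (\<lambda>\<omega>. (h (U j \<omega>))\<^sup>2)"
      using h_sq by (subst (asm) lawU[symmetric, of j], subst (asm) integrable_distr_eq) auto
    then show "integrable M (\<lambda>\<omega>. (Y j \<omega>)\<^sup>2)"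
      by (subst Bochner_Integration.integrable_cong[OF refl, of _ _ "\<lambda>\<omega>. (h (U j \<omega>))\<^sup>2"]) (simp_all add: Y_h)
    have "(\<integral>\<omega>. (Y j \<omega>)\<^sup>2 \<partial>M) = (\<integral>\<omega>. (h (U j \<omega>))\<^sup>2 \<partial>M)"
      by (intro Bochner_Integration.integral_cong) (simp_all add: Y_h)
    also have "\<dots> = A"
      unfolding A_def by (subst lawU[symmetric, of j], subst integral_distr) auto
    finally show "(\<integral>\<omega>. (Y j \<omega>)\<^sup>2 \<partial>M) = A" .
  qed
  have h_mean: "(\<integral>x. h x \<partial>?P) = 0"
  proof -
    have "(\<integral>x. h x \<partial>?P) = (\<integral>\<omega>. h (U 0 \<omega>) \<partial>M)"
      by (subst lawU[symmetric, of 0], subst integral_distr) auto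
    also have "\<dots> = (\<integral>\<omega>. inner (\<epsilon> 0 \<omega>) \<delta> \<partial>M)"
      by (intro Bochner_Integration.integral_cong) (simp_all add: h_def eps)
    finally show ?thesis using int[of 0] mean[of 0] by simp
  qed
  \<comment> \<open>The factor \<open>norm \<delta>\<close> comes from Cauchy-Schwarz in
    \<open>L2\<close>, and \<open>A + 2\<close> from the Hoelder-type bound, \<open>A\<close> being
    the common second moment. Lag 0 is included and bounds the variance.\<close>
  have cov: "\<bar>\<integral>\<omega>. Y (j - int l) \<omega> * Y j \<omega> \<partial>M\<bar> \<le> norm \<delta> * (A + 2) * a l" for j l
  proof -
    let ?i = "j - int l" and ?Z = "\<lambda>\<omega>. h (coupled_past e e' j l \<omega>)"
    have [measurable]: "?Z \<in> borel_measurable M"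
      unfolding coupled using measurable_compose[OF _ splice, of "\<lambda>\<omega>. (U j \<omega>, V j l \<omega>)" M l] by simp
    \<comment> \<open>\<open>Y ?i\<close> is a function of the innovations up to time \<open>j - l\<close>, all of which \<open>?Z\<close> replaces by copies.\<close>
    have uncorr: "(\<integral>\<omega>. Y ?i \<omega> * ?Z \<omega> \<partial>M) = 0"
    proof -
      have "(\<integral>\<omega>. Y ?i \<omega> * ?Z \<omega> \<partial>M)
          = (\<integral>\<omega>. (\<lambda>(u, v). h (\<lambda>k. u (k + l)) * h (comb_seq l u (\<lambda>k. v (k + l)))) (U j \<omega>, V j l \<omega>) \<partial>M)"
        by (intro Bochner_Integration.integral_cong)
          (simp_all add: Y_h coupled, simp add: U_def algebra_simps)
      also have "\<dots> = (\<integral>(u, v). h (\<lambda>k. u (k + l)) * h (comb_seq l u (\<lambda>k. v (k + l))) \<partial>(?P \<Otimes>\<^sub>M ?P))"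
        by (subst law[symmetric, of j l], subst integral_distr) (auto simp: case_prod_beta')
      also have "\<dots> = 0"
        by (rule P.integral_shift_mult_splice_eq_0[OF _ h_mean]) measurable
      finally show ?thesis .
    qed
    have "0 \<le> R j l \<omega>" for \<omega> by (simp add: R_def)
    note R_le = expectation_abs_mult_le_Lp[of "Y ?i" "R j l" p, OF _ _ Y_sq Rint this p]
    have bound: "norm (Y ?i \<omega> * (Y j \<omega> - ?Z \<omega>)) \<le> norm \<delta> * (\<bar>Y ?i \<omega>\<bar> * R j l \<omega>)" for \<omega>
    proof -
      have "\<bar>Y j \<omega> - ?Z \<omega>\<bar> \<le> R j l \<omega> * norm \<delta>"
        unfolding Y_def h_def R_def inner_diff_left[symmetric] by (rule Cauchy_Schwarz_ineq2)
      then show ?thesis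
        using mult_left_mono[of "\<bar>Y j \<omega> - ?Z \<omega>\<bar>" "R j l \<omega> * norm \<delta>" "\<bar>Y ?i \<omega>\<bar>"] by (simp add: abs_mult mult_ac)
    qed
    have dom: "integrable M (\<lambda>\<omega>. norm \<delta> * (\<bar>Y ?i \<omega>\<bar> * R j l \<omega>))"
      by (intro integrable_mult_right R_le(1)) measurable
    have diff: "integrable M (\<lambda>\<omega>. Y ?i \<omega> * (Y j \<omega> - ?Z \<omega>))"
      by (rule Bochner_Integration.integrable_bound[OF dom])
        (use bound in \<open>auto intro!: AE_I2 intro: order_trans[OF _ abs_ge_self]\<close>)
    have "integrable M (\<lambda>\<omega>. Y ?i \<omega> * Y j \<omega>)"
      by (intro integrable_mult_of_squares Y_sq) measurable
    \<comment> \<open>The product with \<open>?Z\<close> is integrable as a difference of integrable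
      products, so its vanishing integral can be split off.\<close>
    from Bochner_Integration.integrable_diff[OF this diff]
    have "integrable M (\<lambda>\<omega>. Y ?i \<omega> * ?Z \<omega>)" by (simp add: algebra_simps)
    then have "(\<integral>\<omega>. Y ?i \<omega> * (Y j \<omega> - ?Z \<omega>) + Y ?i \<omega> * ?Z \<omega> \<partial>M) = (\<integral>\<omega>. Y ?i \<omega> * (Y j \<omega> - ?Z \<omega>) \<partial>M)"
      using diff uncorr by (subst Bochner_Integration.integral_add) auto
    then have "\<bar>\<integral>\<omega>. Y ?i \<omega> * Y j \<omega> \<partial>M\<bar> = norm (\<integral>\<omega>. Y ?i \<omega> * (Y j \<omega> - ?Z \<omega>) \<partial>M)"
      by (simp add: algebra_simps)
    also have "\<dots> \<le> (\<integral>\<omega>. norm \<delta> * (\<bar>Y ?i \<omega>\<bar> * R j l \<omega>) \<partial>M)"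
      by (rule order_trans[OF integral_norm_bound]) (intro integral_mono integrable_norm diff dom bound)
    also have "\<dots> \<le> norm \<delta> * (a l * (A + 2))"
      using R_le(2) by (simp add: R_a Y_A mult_left_mono)
    finally show ?thesis by (simp add: mult_ac)
  qed
  note bound = second_moment_sum_le[of Y "\<lambda>l. norm \<delta> * (A + 2) * a l", OF _ Y_sq cov summable_mult[OF a_sum]]
  show thesis
  proof (rule that[of "2 * (\<Sum>l. norm \<delta> * (A + 2) * a l)"]; fold Y_def)
    fix k
    show "integrable M (\<lambda>\<omega>. (\<Sum>i\<in>{1..int k}. Y i \<omega>)\<^sup>2)"
      by (rule bound[THEN conjunct2]) measurable
    have "(\<integral>\<omega>. (\<Sum>i\<in>{1..int k}. Y i \<omega>)\<^sup>2 \<partial>M) \<le> real k * (2 * (\<Sum>l. norm \<delta> * (A + 2) * a l))"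
      by (rule bound[THEN conjunct1]) measurable
    then show "(\<integral>\<omega>. (\<Sum>i\<in>{1..int k}. Y i \<omega>)\<^sup>2 \<partial>M) \<le> 2 * (\<Sum>l. norm \<delta> * (A + 2) * a l) * real k"
      by (simp only: mult.commute)
  qed
qed


section \<open>The statistic at the change point\<close>

text \<open>The centring cancels \<open>\<mu>\<close>. No observation up to \<open>k\<close>
  contains \<open>\<delta>\<close>, while \<open>n - k\<close> of all \<open>n\<close> do, so only
  the subtracted total carries the signal, with weight \<open>k / n\<close>.\<close>

lemma cusum_at_change_point:
  assumes k: "change_point \<theta> n = int k" and kn: "k \<le> n" and n: "0 < n"
  shows "cusum (observation \<mu> \<delta> \<theta> \<epsilon> n) n k \<omega> = (1 / sqrt (real n)) *\<^sub>R
    ((\<Sum>i\<in>{1..int k}. \<epsilon> i \<omega>) - (real k / real n) *\<^sub>R (\<Sum>i\<in>{1..int n}. \<epsilon> i \<omega>)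
      - (real k * (real n - real k) / real n) *\<^sub>R \<delta>)"
proof -
  let ?X = "\<lambda>i. observation \<mu> \<delta> \<theta> \<epsilon> n i \<omega>"
  have before: "(\<Sum>i\<in>{1..int k}. ?X i) = real k *\<^sub>R \<mu> + (\<Sum>i\<in>{1..int k}. \<epsilon> i \<omega>)"
  proof -
    have "(\<Sum>i\<in>{1..int k}. ?X i) = (\<Sum>i\<in>{1..int k}. \<mu> + \<epsilon> i \<omega>)"
      by (rule sum.cong) (auto simp: observation_def k)
    then show ?thesis by (simp add: sum.distrib sum_constant_scaleR)
  qed
  have "(\<Sum>i\<in>{1..int n}. ?X i)
      = real n *\<^sub>R \<mu> + (\<Sum>i\<in>{1..int n}. if int k < i then \<delta> else 0) + (\<Sum>i\<in>{1..int n}. \<epsilon> i \<omega>)"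
    by (simp add: observation_def k sum.distrib sum_constant_scaleR)
  also have "(\<Sum>i\<in>{1..int n}. if int k < i then \<delta> else 0) = (\<Sum>i\<in>{int k<..int n}. \<delta>)"
    by (rule sum.mono_neutral_cong_right) auto
  also have "\<dots> = (real n - real k) *\<^sub>R \<delta>"
    using kn by (simp add: sum_constant_scaleR of_nat_diff)
  finally have total: "(\<Sum>i\<in>{1..int n}. ?X i)
      = real n *\<^sub>R \<mu> + (real n - real k) *\<^sub>R \<delta> + (\<Sum>i\<in>{1..int n}. \<epsilon> i \<omega>)" .
  have "(real k / real n) *\<^sub>R (\<Sum>i\<in>{1..int n}. ?X i)
      = real k *\<^sub>R \<mu> + (real k * (real n - real k) / real n) *\<^sub>R \<delta>
        + (real k / real n) *\<^sub>R (\<Sum>i\<in>{1..int n}. \<epsilon> i \<omega>)"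
    unfolding total using n by (simp add: scaleR_add_right)
  then show ?thesis
    unfolding cusum_def before by simp
qed

lemma test_statistic_measurable:
  assumes [measurable]: "\<And>i. X i \<in> borel_measurable M" and n: "0 < n"
  shows "test_statistic X n \<in> borel_measurable M"
proof -
  have "(\<lambda>\<omega>. Max ((\<lambda>k. (norm (cusum X n k \<omega>))\<^sup>2) ` {1..n})) \<in> borel_measurable M"
    unfolding cusum_def using n by (intro borel_measurable_Max) auto
  then show ?thesis by (simp add: test_statistic_def[abs_def])
qed

text \<open>A maximum of at most \<open>K\<close> bounds the CUSUM norm at \<open>k\<close>, hence
  by Cauchy-Schwarz its component along \<open>\<delta>\<close>. Rescaled by the root of
  \<open>n\<close>, this component is noise minus signal, so the noise must nearly cancel the
  signal.\<close>

lemma small_test_statistic_imp_large_noise: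
  assumes k: "change_point \<theta> n = int k" and kn: "1 \<le> k" "k \<le> n"
    and T: "test_statistic (observation \<mu> \<delta> \<theta> \<epsilon> n) n \<omega> \<le> K"
  shows "real k * (real n - real k) / real n * (norm \<delta>)\<^sup>2 - sqrt (real n) * sqrt K * norm \<delta>
    \<le> \<bar>(\<Sum>i\<in>{1..int k}. inner (\<epsilon> i \<omega>) \<delta>) - real k / real n * (\<Sum>i\<in>{1..int n}. inner (\<epsilon> i \<omega>) \<delta>)\<bar>"
    (is "?s * _ - _ \<le> \<bar>?Z\<bar>")
proof -
  let ?c = "cusum (observation \<mu> \<delta> \<theta> \<epsilon> n) n k \<omega>"
  have n: "0 < n" using kn by simp
  have "(norm ?c)\<^sup>2 \<le> test_statistic (observation \<mu> \<delta> \<theta> \<epsilon> n) n \<omega>"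
    unfolding test_statistic_def using kn by (intro Max_ge imageI) auto
  with T have "(norm ?c)\<^sup>2 \<le> K" by (rule order_trans[rotated])
  then have "norm ?c \<le> sqrt K" by (simp add: real_le_rsqrt)
  then have "norm ?c * norm \<delta> \<le> sqrt K * norm \<delta>" by (rule mult_right_mono) simp
  with Cauchy_Schwarz_ineq2[of ?c \<delta>] have "\<bar>inner ?c \<delta>\<bar> \<le> sqrt K * norm \<delta>" by simp
  then have "sqrt (real n) * \<bar>inner ?c \<delta>\<bar> \<le> sqrt (real n) * sqrt K * norm \<delta>"
    unfolding mult.assoc by (rule mult_left_mono) simp
  moreover have "sqrt (real n) * inner ?c \<delta> = ?Z - ?s * (norm \<delta>)\<^sup>2"
    unfolding cusum_at_change_point[OF k kn(2) n] using n
    by (simp add: inner_diff_left inner_sum_left power2_norm_eq_inner)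
  then have "\<bar>?Z - ?s * (norm \<delta>)\<^sup>2\<bar> = sqrt (real n) * \<bar>inner ?c \<delta>\<bar>"
    by (metis abs_mult abs_of_nonneg real_sqrt_ge_zero of_nat_0_le_iff)
  moreover have "s - b \<le> \<bar>z\<bar>" if "a \<le> b" "\<bar>z - s\<bar> = a" for a b s z :: real
    using that by linarith
  ultimately show ?thesis by blast
qed

lemma change_point_ratio_tendsto:
  assumes "0 < \<theta>"
  shows "(\<lambda>n. real (nat (change_point \<theta> n)) / real n) \<longlonglongrightarrow> \<theta>"
proof (rule tendsto_sandwich)
  have b: "\<theta> * real n - 1 \<le> real (nat (change_point \<theta> n)) \<and> real (nat (change_point \<theta> n)) \<le> \<theta> * real n" for n
  proof -
    have "0 \<le> change_point \<theta> n" using assms by (simp add: change_point_def)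
    then have "real (nat (change_point \<theta> n)) = of_int (change_point \<theta> n)" by simp
    then show ?thesis unfolding change_point_def by linarith
  qed
  show "\<forall>\<^sub>F n in sequentially. \<theta> - 1 / real n \<le> real (nat (change_point \<theta> n)) / real n"
    using eventually_gt_at_top[of 0]
  proof eventually_elim
    case (elim n)
    then show ?case
      using divide_right_mono[of "\<theta> * real n - 1" "real (nat (change_point \<theta> n))" "real n"] b
      by (simp add: diff_divide_distrib)
  qed
  show "\<forall>\<^sub>F n in sequentially. real (nat (change_point \<theta> n)) / real n \<le> \<theta>"
    using eventually_gt_at_top[of 0]
    by eventually_elim (use b in \<open>simp add: pos_divide_le_eq\<close>)
  show "(\<lambda>n. \<theta> - 1 / real n) \<longlonglongrightarrow> \<theta>"
    using tendsto_diff[OF tendsto_const[of \<theta>] lim_1_over_n] by simp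
qed simp

section \<open>Chebyshev's inequality for the noise against the growing signal\<close>

theorem theorem2p2:
  fixes M :: "'w measure" and S :: "'s measure"
    and g :: "(nat \<Rightarrow> 's) \<Rightarrow> L2"
    and e :: "int \<Rightarrow> 'w \<Rightarrow> 's" and e' :: "int \<Rightarrow> nat \<Rightarrow> int \<Rightarrow> 'w \<Rightarrow> 's"
    and \<epsilon> :: "int \<Rightarrow> 'w \<Rightarrow> L2"
    and \<mu> \<delta> :: L2 and \<theta> :: real
  assumes "prob_space M"
    and "0 < \<theta>" and "\<theta> < 1"
    and "\<And>i. \<epsilon> i \<in> borel_measurable M"
    and "\<And>i. integrable M (\<epsilon> i)" and "\<And>i. (\<integral>\<omega>. \<epsilon> i \<omega> \<partial>M) = 0"
    and "weakly_dependent M S g e e' \<epsilon>"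
    and "\<delta> \<noteq> 0"
  shows "diverges_in_probability M
    (\<lambda>n. test_statistic (observation \<mu> \<delta> \<theta> \<epsilon> n) n)"
proof -
  interpret prob_space M by fact
  note [measurable] = assms(4)
  define W where "W m \<omega> = (\<Sum>i\<in>{1..int m}. inner (\<epsilon> i \<omega>) \<delta>)" for m \<omega>
  define k where "k n = nat (change_point \<theta> n)" for n
  \<comment> \<open>The noise part of the CUSUM at the change point, projected on
    \<open>\<delta>\<close> and without the factor \<open>1 / sqrt n\<close>.\<close>
  define Z where "Z n \<omega> = W (k n) \<omega> - real (k n) / real n * W n \<omega>" for n \<omega>
  obtain C where W_int: "\<And>m. integrable M (\<lambda>\<omega>. (W m \<omega>)\<^sup>2)"
    and W_le: "\<And>m. (\<integral>\<omega>. (W m \<omega>)\<^sup>2 \<partial>M) \<le> C * real m"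
    using weakly_dependent_second_moment_sum_le[OF assms(1,4-7), of \<delta>] unfolding W_def by metis
  have [measurable]: "W m \<in> borel_measurable M" "Z n \<in> borel_measurable M" for m n
    unfolding W_def Z_def by measurable
  have ratio: "(\<lambda>n. real (k n) / real n) \<longlonglongrightarrow> \<theta>"
    unfolding k_def by (rule change_point_ratio_tendsto) fact
  have k_int: "change_point \<theta> n = int (k n)" for n
    using assms(2) by (simp add: k_def change_point_def)
  have k_le: "k n \<le> n" for n
  proof -
    have "\<theta> * real n \<le> real n" using mult_right_mono[of \<theta> 1 "real n"] assms(3) by simp
    then have "change_point \<theta> n \<le> int n" unfolding change_point_def by linarith
    then show ?thesis by (simp add: k_def)
  qed
  \<comment> \<open>The maximum starts at index 1, whereas the change point can be 0 for small
    \<open>n\<close>.\<close>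
  have k_pos: "\<forall>\<^sub>F n in sequentially. 1 \<le> k n"
    using order_tendstoD(1)[OF ratio assms(2)] by eventually_elim (simp add: zero_less_divide_iff)
  have C: "0 \<le> C"
  proof -
    have "0 \<le> (\<integral>\<omega>. (W 1 \<omega>)\<^sup>2 \<partial>M)" by simp
    also note W_le[of 1]
    finally show ?thesis by simp
  qed
  have Z_bound: "(Z n \<omega>)\<^sup>2 \<le> 2 * (W (k n) \<omega>)\<^sup>2 + 2 * (W n \<omega>)\<^sup>2" for n \<omega>
  proof -
    let ?y = "real (k n) / real n * W n \<omega>"
    have "real (k n) / real n \<le> 1" using k_le[of n] by (cases "n = 0") (simp_all add: divide_le_eq_1)
    then have "(real (k n) / real n)\<^sup>2 * (W n \<omega>)\<^sup>2 \<le> 1 * (W n \<omega>)\<^sup>2"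
      by (intro mult_right_mono power_le_one) auto
    then have y: "?y\<^sup>2 \<le> (W n \<omega>)\<^sup>2" unfolding power_mult_distrib by simp
    have "0 \<le> (W (k n) \<omega> + ?y)\<^sup>2" by simp
    then have "(Z n \<omega>)\<^sup>2 \<le> 2 * (W (k n) \<omega>)\<^sup>2 + 2 * ?y\<^sup>2"
      unfolding Z_def power2_diff power2_sum by linarith
    with y show ?thesis by linarith
  qed
  have Z_int: "integrable M (\<lambda>\<omega>. (Z n \<omega>)\<^sup>2)" for n
    by (rule Bochner_Integration.integrable_bound[of _ "\<lambda>\<omega>. 2 * (W (k n) \<omega>)\<^sup>2 + 2 * (W n \<omega>)\<^sup>2"])
      (use W_int Z_bound in \<open>auto intro!: AE_I2\<close>)
  have Z_le: "(\<integral>\<omega>. (Z n \<omega>)\<^sup>2 \<partial>M) \<le> 4 * C * real n" for n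
  proof -
    have "(\<integral>\<omega>. (Z n \<omega>)\<^sup>2 \<partial>M) \<le> (\<integral>\<omega>. 2 * (W (k n) \<omega>)\<^sup>2 + 2 * (W n \<omega>)\<^sup>2 \<partial>M)"
      by (intro integral_mono Z_int Z_bound) (use W_int in simp)
    also have "\<dots> = 2 * (\<integral>\<omega>. (W (k n) \<omega>)\<^sup>2 \<partial>M) + 2 * (\<integral>\<omega>. (W n \<omega>)\<^sup>2 \<partial>M)"
      using W_int by simp
    also have "\<dots> \<le> 2 * (C * real (k n)) + 2 * (C * real n)"
      by (intro add_mono mult_left_mono W_le) auto
    also have "C * real (k n) \<le> C * real n"
      using k_le C by (intro mult_left_mono) auto
    finally show ?thesis by simp
  qed
  \<comment> \<open>The limit of the unscaled signal divided by \<open>n\<close>.\<close>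
  define \<beta> where "\<beta> = \<theta> * (1 - \<theta>) * (norm \<delta>)\<^sup>2"
  have \<beta>: "0 < \<beta>" using assms by (simp add: \<beta>_def)
  show ?thesis unfolding diverges_in_probability_def
  proof
    fix K :: real
    let ?T = "\<lambda>n. test_statistic (observation \<mu> \<delta> \<theta> \<epsilon> n) n"
    \<comment> \<open>The noise level forced by a statistic of at most \<open>K\<close>. Its second
      term is only of order \<open>sqrt n\<close>, so \<open>b n / n\<close> tends to
      \<open>\<beta>\<close> and eventually exceeds \<open>\<beta> / 2\<close>.\<close>
    define b where "b n = real (k n) * (real n - real (k n)) / real n * (norm \<delta>)\<^sup>2
      - sqrt (real n) * sqrt K * norm \<delta>" for n
    have "(\<lambda>n. real (k n) / real n * (1 - real (k n) / real n) * (norm \<delta>)\<^sup>2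
        - 1 / sqrt (real n) * (sqrt K * norm \<delta>)) \<longlonglongrightarrow> \<theta> * (1 - \<theta>) * (norm \<delta>)\<^sup>2 - 0 * (sqrt K * norm \<delta>)"
      using tendsto_real_sqrt[OF lim_1_over_n] by (intro tendsto_intros ratio) (simp add: real_sqrt_divide)
    then have "\<forall>\<^sub>F n in sequentially. \<beta> / 2 < real (k n) / real n * (1 - real (k n) / real n) * (norm \<delta>)\<^sup>2
        - 1 / sqrt (real n) * (sqrt K * norm \<delta>)"
      using \<beta> by (intro order_tendstoD(1)) (auto simp: \<beta>_def)
    then have b_ge: "\<forall>\<^sub>F n in sequentially. real n * (\<beta> / 2) \<le> b n"
      using eventually_gt_at_top[of 0]
    proof eventually_elim
      case (elim n)
      have "1 / sqrt (real n) = sqrt (real n) / real n"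
        using elim(2) by (simp add: real_div_sqrt field_simps)
      then have "real n * (real (k n) / real n * (1 - real (k n) / real n) * (norm \<delta>)\<^sup>2
        - 1 / sqrt (real n) * (sqrt K * norm \<delta>)) = b n"
        using elim(2) by (simp add: b_def field_simps)
      with mult_left_mono[OF less_imp_le[OF elim(1)], of "real n"] show ?case by simp
    qed
    \<comment> \<open>Chebyshev at level \<open>n * \<beta> / 2\<close> with second moment at most
      \<open>4 * C * n\<close> gives the error \<open>16 * C / (\<beta>^2 * n)\<close>, which
      vanishes for every \<open>K\<close>.\<close>
    have prob_le: "\<forall>\<^sub>F n in sequentially. 1 - 16 * C / \<beta>\<^sup>2 / real n \<le> prob {\<omega> \<in> space M. ?T n \<omega> > K}"
      using b_ge k_pos eventually_gt_at_top[of 0]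
    proof eventually_elim
      case (elim n)
      have [measurable]: "?T n \<in> borel_measurable M"
        by (rule test_statistic_measurable[OF _ elim(3)]) (simp add: observation_def[abs_def])
      have "{\<omega> \<in> space M. ?T n \<omega> \<le> K} \<subseteq> {\<omega> \<in> space M. \<bar>Z n \<omega>\<bar> \<ge> real n * (\<beta> / 2)}"
      proof (intro subsetI CollectI conjI; clarify)
        fix \<omega> assume "?T n \<omega> \<le> K"
        from small_test_statistic_imp_large_noise[OF k_int elim(2) k_le this]
        have "b n \<le> \<bar>Z n \<omega>\<bar>" by (simp only: Z_def W_def b_def)
        then show "real n * (\<beta> / 2) \<le> \<bar>Z n \<omega>\<bar>" using elim(1) by (rule order_trans[rotated])
      qed
      then have "prob {\<omega> \<in> space M. ?T n \<omega> \<le> K} \<le> prob {\<omega> \<in> space M. \<bar>Z n \<omega>\<bar> \<ge> real n * (\<beta> / 2)}"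
        by (intro finite_measure_mono) measurable
      also have "\<dots> \<le> (\<integral>\<omega>. (Z n \<omega>)\<^sup>2 \<partial>M) / (real n * (\<beta> / 2))\<^sup>2"
        using \<beta> elim(3) by (intro second_moment_method Z_int) auto
      also have "\<dots> \<le> 4 * C * real n / (real n * (\<beta> / 2))\<^sup>2"
        by (intro divide_right_mono Z_le) simp
      also have "\<dots> = 16 * C / \<beta>\<^sup>2 / real n"
        using \<beta> elim(3) by (simp add: power2_eq_square field_simps)
      finally have "prob {\<omega> \<in> space M. ?T n \<omega> \<le> K} \<le> 16 * C / \<beta>\<^sup>2 / real n" .
      moreover have "prob {\<omega> \<in> space M. \<not> ?T n \<omega> \<le> K} = 1 - prob {\<omega> \<in> space M. ?T n \<omega> \<le> K}"
        by (rule prob_neg) measurable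
      ultimately show ?case by (simp add: not_le)
    qed
    show "(\<lambda>n. prob {\<omega> \<in> space M. ?T n \<omega> > K}) \<longlonglongrightarrow> 1"
    proof (rule tendsto_sandwich[OF prob_le _ _ tendsto_const])
      show "(\<lambda>n. 1 - 16 * C / \<beta>\<^sup>2 / real n) \<longlonglongrightarrow> 1"
        using tendsto_diff[OF tendsto_const[of 1] lim_const_over_n[of "16 * C / \<beta>\<^sup>2"]] by simp
    qed simp
  qed
qed

end
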